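(* Let $d\ge1$, let $p\in(0,1)$ and let $n$ be a positive integer such that $pn$ is an integer. Let $D_p$ be the uniform distribution on all $x\in\{\pm1\}^n$ with $\sum_{i=1}^n x_i=(1-2p)n$, and put $$K=12\cdot d^{3/2}\cdot\left(256\cdot\Big(\big(\tfrac{1-p}{p}\big)^2+\big(\tfrac{p}{1-p}\big)^2\Big)^2\right)^d .$$ For every multilinear polynomial $f$ of degree at most $d$ in $\phi_1,\dots,\phi_n$, $$\mathbb E_{D_p}[f(\phi_1,\dots,\phi_n)^4]\le K\cdot\big(\mathbb E_{D_p}[f(\phi_1,\dots,\phi_n)^2]\big)^2 .$$ Also, for every multilinear polynomial $g$ of degree at most $d$ in $x_1,\dots,x_n$, $$\mathbb E_{D_p}[g(x_1,\dots,x_n)^4]\le K\cdot\big(\mathbb E_{D_p}[g(x_1,\dots,x_n)^2]\big)^2 .$$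
   Context: For $x\in\{\pm1\}^n$ and $i\in[n]$, $\phi_i=\phi_i(x)$ equals $\sqrt{p/(1-p)}$ if $x_i=1$ and $-\sqrt{(1-p)/p}$ if $x_i=-1$. Polynomials have real coefficients. *)

theory Defs
  imports "HOL-Probability.Probability" "HOL-Library.Poly_Mapping"
begin

text \<open>
  A real polynomial in variables indexed by \<^typ>\<open>nat\<close> is a finitely supported map from
  monomials to coefficients, and a monomial is a finitely supported map from variables to exponents.
\<close>

type_synonym monomial = "nat \<Rightarrow>\<^sub>0 nat"
type_synonym rmpoly = "monomial \<Rightarrow>\<^sub>0 real"

definition monomial_degree :: "monomial \<Rightarrow> nat" where
  "monomial_degree m = (\<Sum>i\<in>Poly_Mapping.keys m. Poly_Mapping.lookup m i)"

text \<open>The zero polynomial gets total degree 0.\<close>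

definition total_degree :: "rmpoly \<Rightarrow> nat" where
  "total_degree f = Max (insert 0 (monomial_degree ` Poly_Mapping.keys f))"

definition poly_vars :: "rmpoly \<Rightarrow> nat set" where
  "poly_vars f = (\<Union>m\<in>Poly_Mapping.keys f. Poly_Mapping.keys m)"

definition multilinear :: "rmpoly \<Rightarrow> bool" where
  "multilinear f \<longleftrightarrow> (\<forall>m\<in>Poly_Mapping.keys f. \<forall>i. Poly_Mapping.lookup m i \<le> 1)"

definition eval_poly :: "rmpoly \<Rightarrow> (nat \<Rightarrow> real) \<Rightarrow> real" where
  "eval_poly f y = (\<Sum>m\<in>Poly_Mapping.keys f.
     Poly_Mapping.lookup f m * (\<Prod>i\<in>Poly_Mapping.keys m. y i ^ Poly_Mapping.lookup m i))"

definition slice :: "nat \<Rightarrow> real \<Rightarrow> (nat \<Rightarrow> real) set" where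
  "slice n p = {x \<in> {1..n} \<rightarrow>\<^sub>E {-1, 1}. (\<Sum>i=1..n. x i) = (1 - 2 * p) * real n}"

definition slice_pmf :: "nat \<Rightarrow> real \<Rightarrow> (nat \<Rightarrow> real) pmf" where
  "slice_pmf n p = pmf_of_set (slice n p)"

text \<open>\<^const>\<open>pmf_of_set\<close> is only meaningful on finite nonempty sets.\<close>

lemma finite_slice: "finite (slice n p)"
proof -
  have "finite ({1..n} \<rightarrow>\<^sub>E {-1, 1::real})"
    by (intro finite_PiE) auto
  then show ?thesis
    unfolding slice_def by simp
qed

lemma slice_nonempty:
  assumes "0 \<le> p" "p \<le> 1" "p * real n \<in> \<int>"
  shows "slice n p \<noteq> {}"
proof -
  obtain k :: int where k: "p * real n = of_int k"
    using assms(3) by (elim Ints_cases)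
  define m where "m = nat k"
  have "0 \<le> p * real n"
    using assms by simp
  then have "k \<ge> 0"
    using k by simp
  then have m: "p * real n = real m"
    using k by (simp add: m_def)
  have "p * real n \<le> 1 * real n"
    using assms by (intro mult_right_mono) auto
  then have mn: "m \<le> n"
    using m by simp
  define x :: "nat \<Rightarrow> real" where "x = restrict (\<lambda>i. if i \<le> m then -1 else 1) {1..n}"
  have "(\<Sum>i=1..n. x i) = (\<Sum>i=1..n. if i \<le> m then -1 else 1)"
    by (intro sum.cong) (auto simp: x_def)
  also have "\<dots> = (\<Sum>i\<in>{1..m} \<union> {m<..n}. if i \<le> m then -1 else 1)"
    using mn by (intro sum.cong) auto
  also have "\<dots> = (\<Sum>i\<in>{1..m}. if i \<le> m then -1 else 1) + (\<Sum>i\<in>{m<..n}. if i \<le> m then -1 else 1)"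
    by (intro sum.union_disjoint) auto
  also have "\<dots> = (\<Sum>i\<in>{1..m}. -1) + (\<Sum>i\<in>{m<..n}. 1)"
    by (intro arg_cong2[of _ _ _ _ "(+)"] sum.cong) auto
  also have "\<dots> = (1 - 2 * p) * real n"
    using m mn by (simp add: algebra_simps of_nat_diff)
  finally have "x \<in> slice n p"
    unfolding slice_def by (auto simp: x_def)
  then show ?thesis by blast
qed

text \<open>The \<open>p\<close>-biased Fourier character of a single coordinate \<open>t \<in> {-1, 1}\<close>.\<close>

definition phi :: "real \<Rightarrow> real \<Rightarrow> real" where
  "phi p t = (if t = 1 then sqrt (p / (1 - p)) else - sqrt ((1 - p) / p))"

definition hyper_const :: "nat \<Rightarrow> real \<Rightarrow> real" where
  "hyper_const d p = 12 * real d powr (3/2) *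
     (256 * (((1 - p) / p)\<^sup>2 + (p / (1 - p))\<^sup>2)\<^sup>2) ^ d"

end

theory Submission
  imports Defs
begin

text \<open>
  Encode \<open>x\<close> by the set \<open>X\<close> of its coordinates equal to \<open>-1\<close>, so that the slice becomes a layer
  \<open>card X = k\<close> with \<open>k = p n\<close>. Since \<open>\<Sum>i. \<phi>\<^sub>i = 0\<close> on this layer, every function of degree at most \<open>d\<close>
  agrees there with \<open>f = \<Sum>S. c S \<phi>\<^sub>S\<close>, where \<open>c\<close> is harmonic: \<open>\<Sum>a\<notin>T. c (insert a T) = 0\<close> for all \<open>T\<close>.
  The homogeneous parts of such an \<open>f\<close> are orthogonal both on the layer and under the \<open>p\<close>-biased product
  measure, and an explicit eigenvalue shows \<open>E\<^sub>D f\<^sup>2 \<ge> exp (- d) E\<^sub>U f\<^sup>2\<close> for \<open>d \<le> min k (n - k)\<close>; a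
  larger \<open>d\<close> adds no functions on the layer. Conversely, with \<open>h = f\<^sup>4\<close> of degree \<open>4 d\<close>, Cauchy-Schwarz gives
  \<open>(E\<^sub>D h)\<^sup>2 \<le> W E\<^sub>U h\<^sup>2\<close> with \<open>W = \<Sum>card S \<le> 4 d. (E\<^sub>D \<phi>\<^sub>S)\<^sup>2\<close>, and two applications of the \<open>(2, 4)\<close>
  hypercontractive inequality of the product measure bound \<open>E\<^sub>U f\<^sup>8\<close> by a power of \<open>E\<^sub>U f\<^sup>2\<close>. For
  \<open>n < 144 d\<^sup>3\<close> one can replace \<open>W\<close> by \<open>n + 1\<close>, because a binomial distribution on \<open>{0..n}\<close> charges its mode
  with at least \<open>1 / (n + 1)\<close>; for larger \<open>n\<close> the three-term recursion for \<open>E\<^sub>D \<phi>\<^sub>S\<close>, obtained by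
  averaging \<open>\<phi>\<^sub>S \<Sum>i. \<phi>\<^sub>i = 0\<close>, bounds \<open>W\<close>.
\<close>

section \<open>Projection and finite sums over subsets\<close>

text \<open>Gram-Schmidt by induction on \<open>J\<close>: the residual \<open>w\<close> of the new
  vector \<open>v j0\<close> against the old ones is orthogonal to them, so subtracting a multiple
  of \<open>w\<close> keeps the relations already achieved. \<open>harmonic_representation\<close>
  uses this to split the top-degree coefficients.\<close>

lemma orthogonal_projection_exists:
  fixes v :: "'b \<Rightarrow> 'a \<Rightarrow> real"
  assumes "finite J"
  shows "\<exists>e. \<forall>j\<in>J. (\<Sum>s\<in>A. (c s - (\<Sum>i\<in>J. e i * v i s)) * v j s) = 0"
  using assms
proof (induction J arbitrary: c rule: finite_induct)
  case empty
  then show ?case by simp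
next
  case (insert j0 J)
  obtain e0 where e0: "\<And>j. j \<in> J \<Longrightarrow> (\<Sum>s\<in>A. (v j0 s - (\<Sum>i\<in>J. e0 i * v i s)) * v j s) = 0"
    using insert.IH[of "v j0"] by blast
  obtain e1 where e1: "\<And>j. j \<in> J \<Longrightarrow> (\<Sum>s\<in>A. (c s - (\<Sum>i\<in>J. e1 i * v i s)) * v j s) = 0"
    using insert.IH[of c] by blast
  define w where "w s = v j0 s - (\<Sum>i\<in>J. e0 i * v i s)" for s
  define h where "h s = c s - (\<Sum>i\<in>J. e1 i * v i s)" for s
  \<comment> \<open>If \<open>w\<close> vanishes on \<open>A\<close>, division by zero makes
    \<open>t\<close> equal to 0, and the sum of \<open>h s * w s\<close> is 0 as well.\<close>
  define t where "t = (\<Sum>s\<in>A. h s * w s) / (\<Sum>s\<in>A. w s * w s)"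
  define e where "e i = (if i = j0 then t else e1 i - t * e0 i)" for i
  have res: "c s - (\<Sum>i\<in>insert j0 J. e i * v i s) = h s - t * w s" for s
  proof -
    have "(\<Sum>i\<in>J. e i * v i s) = (\<Sum>i\<in>J. e1 i * v i s - t * (e0 i * v i s))"
      using insert.hyps by (intro sum.cong) (auto simp: e_def algebra_simps)
    also have "\<dots> = (\<Sum>i\<in>J. e1 i * v i s) - t * (\<Sum>i\<in>J. e0 i * v i s)"
      by (simp add: sum_subtractf sum_distrib_left)
    finally show ?thesis
      using insert.hyps by (simp add: h_def w_def e_def algebra_simps)
  qed
  have wv: "(\<Sum>s\<in>A. w s * v j s) = 0" and hv: "(\<Sum>s\<in>A. h s * v j s) = 0" if "j \<in> J" for j
    using e0[OF that] e1[OF that] by (simp_all add: w_def h_def)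
  have old: "(\<Sum>s\<in>A. (h s - t * w s) * v j s) = 0" if "j \<in> J" for j
  proof -
    have "(\<Sum>s\<in>A. (h s - t * w s) * v j s)
        = (\<Sum>s\<in>A. h s * v j s) - t * (\<Sum>s\<in>A. w s * v j s)"
      by (simp add: left_diff_distrib sum_subtractf sum_distrib_left mult.assoc)
    then show ?thesis
      using wv[OF that] hv[OF that] by simp
  qed
  have "(\<Sum>s\<in>A. (h s - t * w s) * w s) = (\<Sum>s\<in>A. h s * w s) - t * (\<Sum>s\<in>A. w s * w s)"
    by (simp add: left_diff_distrib sum_subtractf sum_distrib_left mult.assoc)
  also have "\<dots> = 0"
  proof (cases "finite A \<and> (\<Sum>s\<in>A. w s * w s) = 0")
    case True
    then have "\<forall>s\<in>A. w s * w s = 0"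
      using sum_nonneg_eq_0_iff[of A "\<lambda>s. w s * w s"] by simp
    then show ?thesis by simp
  next
    case False
    then show ?thesis by (cases "finite A") (auto simp: t_def)
  qed
  finally have ww: "(\<Sum>s\<in>A. (h s - t * w s) * w s) = 0" .
  \<comment> \<open>\<open>v j0\<close> is \<open>w\<close> plus a combination of the old vectors,
    and the new residual is orthogonal to each of these.\<close>
  have "(\<Sum>s\<in>A. (h s - t * w s) * v j0 s)
      = (\<Sum>s\<in>A. (h s - t * w s) * w s + (\<Sum>i\<in>J. e0 i * ((h s - t * w s) * v i s)))"
    by (intro sum.cong refl) (simp add: w_def right_diff_distrib sum_distrib_left mult.left_commute)
  also have "\<dots> = (\<Sum>i\<in>J. e0 i * (\<Sum>s\<in>A. (h s - t * w s) * v i s))"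
    using ww by (simp add: sum.distrib sum.swap[of _ J A] sum_distrib_left)
  also have "\<dots> = 0"
    using old by simp
  finally show ?case
    using old by (intro exI[of _ e]) (auto simp only: res insert_iff)
qed

lemma prod_indicator:
  "finite A \<Longrightarrow> (\<Prod>i\<in>A. if P i then 1 else 0) = (if \<forall>i\<in>A. P i then 1 else (0 :: real))"
  by (induction A rule: finite_induct) auto

lemma sum_Pow_insert:
  assumes "finite N" "a \<notin> N"
  shows "(\<Sum>X\<in>Pow (insert a N). F X) = (\<Sum>X\<in>Pow N. F X) + (\<Sum>X\<in>Pow N. F (insert a X))"
proof -
  have "inj_on (insert a) (Pow N)"
    using assms(2) by (auto simp: inj_on_def)
  then show ?thesis
    using assms by (subst Pow_insert, subst sum.union_disjoint) (auto simp: sum.reindex)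
qed

subsection \<open>Layers of the cube\<close>

definition layer :: "'a set \<Rightarrow> nat \<Rightarrow> 'a set set" where
  "layer N k = {X \<in> Pow N. card X = k}"

definition layer_mean :: "'a set \<Rightarrow> nat \<Rightarrow> ('a set \<Rightarrow> real) \<Rightarrow> real" where
  "layer_mean N k F = (\<Sum>X\<in>layer N k. F X) / real (card N choose k)"

lemma finite_layer: "finite N \<Longrightarrow> finite (layer N k)"
  by (simp add: layer_def)

lemma card_layer: "finite N \<Longrightarrow> card (layer N k) = card N choose k"
  using n_subsets[of N k] by (simp add: layer_def)

text \<open>Translates sums over the sets just above \<open>T\<close> into the indexing by an added
  element that \<open>harmonic\<close> uses.\<close>

lemma sum_upper_shadow:
  fixes f :: "'a set \<Rightarrow> real"
  assumes "finite N" "T \<subseteq> N"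
  shows "(\<Sum>S | S \<in> Pow N \<and> card S = Suc (card T) \<and> T \<subseteq> S. f S) = (\<Sum>a\<in>N - T. f (insert a T))"
proof -
  have fin: "finite T"
    using assms by (rule finite_subset[rotated])
  have "{S \<in> Pow N. card S = Suc (card T) \<and> T \<subseteq> S} = (\<lambda>a. insert a T) ` (N - T)"
  proof (intro equalityI subsetI)
    fix S assume S: "S \<in> {S \<in> Pow N. card S = Suc (card T) \<and> T \<subseteq> S}"
    then have "card (S - T) = 1"
      using fin by (simp add: card_Diff_subset)
    then obtain a where "S - T = {a}"
      by (auto simp: card_1_singleton_iff)
    then have "a \<in> N - T" "S = insert a T"
      using S by auto
    then show "S \<in> (\<lambda>a. insert a T) ` (N - T)"
      by blast
  qed (use assms fin in auto)
  moreover have "inj_on (\<lambda>a. insert a T) (N - T)"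
    by (auto simp: inj_on_def)
  ultimately show ?thesis
    by (simp add: sum.reindex)
qed

text \<open>Glue a bijection from \<open>A\<close> to \<open>B\<close> with one between the
  complements. It supplies the permutations for symmetry arguments on a layer.\<close>

lemma bij_betw_image_exists:
  assumes "finite M" "A \<subseteq> M" "B \<subseteq> M" "card A = card B"
  shows "\<exists>f. bij_betw f M M \<and> f ` A = B"
proof -
  have fin: "finite A" "finite B"
    using assms by (auto intro: finite_subset)
  obtain f where f: "bij_betw f A B"
    using finite_same_card_bij[OF fin assms(4)] by auto
  have "card (M - A) = card (M - B)"
    using assms fin by (simp add: card_Diff_subset)
  then obtain g where g: "bij_betw g (M - A) (M - B)"
    using finite_same_card_bij[of "M - A" "M - B"] assms(1) by auto
  have "bij_betw (\<lambda>x. if x \<in> A then f x else g x) (A \<union> (M - A)) (B \<union> (M - B))"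
    using f g by (intro bij_betw_disjoint_Un) auto
  moreover have "A \<union> (M - A) = M" "B \<union> (M - B) = M"
    using assms by auto
  moreover have "(\<lambda>x. if x \<in> A then f x else g x) ` A = B"
    using f by (simp add: bij_betw_def)
  ultimately show ?thesis
    by metis
qed

text \<open>A permutation of \<open>N\<close> maps the finite layer injectively into itself, hence
  permutes it.\<close>

lemma layer_mean_permute:
  assumes "finite N" "bij_betw f N N"
  shows "layer_mean N k (\<lambda>X. F (f ` X)) = layer_mean N k F"
proof -
  have inj: "inj_on ((`) f) (layer N k)"
    using bij_betw_Pow[OF assms(2)] by (auto simp: bij_betw_def layer_def intro: inj_on_subset)
  have "card (f ` X) = card X" if "X \<subseteq> N" for X
    using that assms(2) by (auto simp: bij_betw_def intro!: card_image intro: inj_on_subset)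
  moreover have "f ` X \<subseteq> N" if "X \<subseteq> N" for X
    using that assms(2) by (auto simp: bij_betw_def)
  ultimately have "(`) f ` layer N k \<subseteq> layer N k"
    by (auto simp: layer_def)
  then have "(`) f ` layer N k = layer N k"
    using endo_inj_surj finite_layer[OF assms(1)] inj by blast
  then have "bij_betw ((`) f) (layer N k) (layer N k)"
    using inj by (simp add: bij_betw_def)
  from sum.reindex_bij_betw[OF this, of F] show ?thesis
    by (simp add: layer_mean_def)
qed

lemma layer_mean_add: "layer_mean N k (\<lambda>X. F X + G X) = layer_mean N k F + layer_mean N k G"
  by (simp add: layer_mean_def sum.distrib add_divide_distrib)

lemma layer_mean_scale: "layer_mean N k (\<lambda>X. r * F X) = r * layer_mean N k F"
  unfolding layer_mean_def sum_distrib_left[symmetric] by simp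

lemma layer_mean_sum: "layer_mean N k (\<lambda>X. \<Sum>i\<in>I. F i X) = (\<Sum>i\<in>I. layer_mean N k (F i))"
  unfolding layer_mean_def by (subst sum.swap) (simp add: sum_divide_distrib)

lemma layer_mean_cong: "(\<And>X. X \<in> layer N k \<Longrightarrow> F X = G X) \<Longrightarrow> layer_mean N k F = layer_mean N k G"
  by (simp add: layer_mean_def)

lemma layer_insert:
  assumes "finite N" "a \<notin> N"
  shows "(\<Sum>X\<in>layer (insert a N) (Suc k). F X)
    = (\<Sum>X\<in>layer N (Suc k). F X) + (\<Sum>X\<in>layer N k. F (insert a X))"
proof -
  have "layer (insert a N) (Suc k) = layer N (Suc k) \<union> insert a ` layer N k"
  proof (intro equalityI subsetI)
    fix X assume X: "X \<in> layer (insert a N) (Suc k)"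
    then have fin: "finite X"
      using assms by (auto simp: layer_def intro: finite_subset)
    show "X \<in> layer N (Suc k) \<union> insert a ` layer N k"
    proof (cases "a \<in> X")
      case True
      then have "X = insert a (X - {a})" "X - {a} \<in> layer N k"
        using X fin by (auto simp: layer_def)
      then show ?thesis by blast
    next
      case False
      then show ?thesis
        using X by (auto simp: layer_def)
    qed
  next
    fix X assume "X \<in> layer N (Suc k) \<union> insert a ` layer N k"
    moreover have "card (insert a Y) = Suc (card Y)" if "Y \<subseteq> N" for Y
      using that assms by (intro card_insert_disjoint) (auto intro: finite_subset)
    ultimately show "X \<in> layer (insert a N) (Suc k)"
      by (auto simp: layer_def)
  qed
  moreover have "layer N (Suc k) \<inter> insert a ` layer N k = {}"
    using assms(2) by (auto simp: layer_def)
  moreover have "inj_on (insert a) (layer N k)"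
    using assms(2) by (auto simp: inj_on_def layer_def)
  ultimately show ?thesis
    using assms(1) by (simp add: sum.union_disjoint finite_layer sum.reindex)
qed

lemma layer_mean_squared_le:
  assumes "finite N" "k \<le> card N"
  shows "(layer_mean N k F)\<^sup>2 \<le> layer_mean N k (\<lambda>X. (F X)\<^sup>2)"
proof -
  have ch: "0 < real (card N choose k)"
    using assms(2) by simp
  have "(\<Sum>X\<in>layer N k. F X * 1)\<^sup>2 \<le> (\<Sum>X\<in>layer N k. (F X)\<^sup>2) * (\<Sum>X\<in>layer N k. 1\<^sup>2)"
    by (rule Cauchy_Schwarz_ineq_sum)
  then have "(\<Sum>X\<in>layer N k. F X)\<^sup>2 \<le> (\<Sum>X\<in>layer N k. (F X)\<^sup>2) * real (card N choose k)"
    by (simp add: card_layer[OF assms(1)])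
  then show ?thesis
    using ch by (simp add: layer_mean_def power_divide field_simps power2_eq_square)
qed

lemma sum_Pow_by_card:
  fixes f :: "'a set \<Rightarrow> real"
  assumes "finite N" "\<And>S. S \<subseteq> N \<Longrightarrow> d < card S \<Longrightarrow> f S = 0"
  shows "(\<Sum>S\<in>Pow N. f S) = (\<Sum>i\<le>d. \<Sum>S\<in>layer N i. f S)"
proof -
  have "(\<Sum>S\<in>Pow N. f S) = (\<Sum>S | S \<in> Pow N \<and> card S \<le> d. f S)"
    using assms by (intro sum.mono_neutral_right) (auto simp: not_le)
  also have "\<dots> = (\<Sum>i\<le>d. \<Sum>S | S \<in> {S. S \<in> Pow N \<and> card S \<le> d} \<and> card S = i. f S)"
    using assms(1) by (intro sum.group[symmetric]) auto
  also have "\<dots> = (\<Sum>i\<le>d. \<Sum>S\<in>layer N i. f S)"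
    by (intro sum.cong refl) (auto simp: layer_def)
  finally show ?thesis .
qed

lemma layer_mean_nonneg: "(\<And>X. X \<subseteq> N \<Longrightarrow> 0 \<le> F X) \<Longrightarrow> 0 \<le> layer_mean N k F"
  unfolding layer_mean_def by (intro divide_nonneg_nonneg sum_nonneg) (auto simp: layer_def)

subsection \<open>Numerical estimates\<close>

text \<open>The induction step is the estimate \<open>(1 + 1 / i) ^ i <= e\<close>.\<close>

lemma power_self_le_exp_mult_fact: "real i ^ i \<le> exp (real i) * fact i"
proof (induction i)
  case 0
  then show ?case by simp
next
  case (Suc i)
  have "real (Suc i) ^ i \<le> real i ^ i * exp 1"
  proof (cases "i = 0")
    case False
    have "(1 + 1 / real i) ^ i \<le> exp (1 / real i) ^ i"
      by (intro power_mono) auto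
    also have "\<dots> = exp 1"
      using False by (simp flip: exp_of_nat_mult)
    finally have "real i ^ i * (1 + 1 / real i) ^ i \<le> real i ^ i * exp 1"
      by (intro mult_left_mono) auto
    moreover have "real i ^ i * (1 + 1 / real i) ^ i = real (Suc i) ^ i"
      using False by (simp add: distrib_left add.commute flip: power_mult_distrib)
    ultimately show ?thesis by simp
  qed simp
  also have "\<dots> \<le> (exp (real i) * fact i) * exp 1"
    using Suc by (intro mult_right_mono) auto
  finally have "real (Suc i) * real (Suc i) ^ i \<le> real (Suc i) * ((exp (real i) * fact i) * exp 1)"
    by (intro mult_left_mono) auto
  then show ?case
    by (simp add: exp_add algebra_simps)
qed

text \<open>The product grows with \<open>m\<close>, so the worst case is \<open>m = i\<close>,
  where it equals \<open>fact i / i ^ i\<close>.\<close>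

lemma exp_minus_le_falling_ratio:
  assumes "i \<le> m"
  shows "exp (- real i) \<le> (\<Prod>j<i. 1 - real j / real m)"
proof (cases "i = 0")
  case False
  have "exp (- real i) \<le> fact i / real i ^ i"
    using power_self_le_exp_mult_fact[of i] False by (simp add: exp_minus field_simps)
  also have "fact i = (\<Prod>j<i. real i - real j)"
    unfolding fact_prod_rev of_nat_prod atLeast0LessThan by (intro prod.cong) (auto simp: of_nat_diff)
  also have "\<dots> / real i ^ i = (\<Prod>j<i. 1 - real j / real i)"
  proof -
    have "(\<Prod>j<i. 1 - real j / real i) = (\<Prod>j<i. (real i - real j) / real i)"
      using False by (intro prod.cong) (auto simp: diff_divide_distrib)
    then show ?thesis
      by (simp add: prod_dividef)
  qed
  also have "\<dots> \<le> (\<Prod>j<i. 1 - real j / real m)"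
    using assms False by (intro prod_mono) (auto simp: field_simps intro: mult_left_mono)
  finally show ?thesis .
qed simp

text \<open>Two absorption identities combined. Passing from degree \<open>i\<close> to
  \<open>i + 1\<close> in \<open>harmonic_eigenvalue\<close> lowers the upper index by 2 and the
  lower one by 1.\<close>

lemma binomial_step_two:
  assumes "0 < k" "k < n"
  shows "real ((n - 2) choose (k - 1)) * (real n * (real n - 1)) = real (n choose k) * (real k * (real n - real k))"
proof -
  obtain l where k: "k = Suc l"
    using assms by (cases k) auto
  obtain m where n: "n = Suc (Suc m)"
    using assms k by (metis Suc_lessE less_Suc_eq_0_disj not_less_eq old.nat.exhaust)
  have l: "l \<le> m"
    using assms k n by simp
  have "Suc l * (n choose k) = n * (Suc m choose l)"
    unfolding k n by (rule Suc_times_binomial)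
  moreover have "(Suc m - l) * (Suc m choose l) = Suc m * (m choose l)"
    using binomial_absorb_comp[of "Suc m" l] by simp
  ultimately have "(n choose k) * (Suc l * (Suc m - l)) = (m choose l) * (n * Suc m)"
    by (metis mult.assoc mult.commute)
  then have "real ((n choose k) * (Suc l * (Suc m - l))) = real ((m choose l) * (n * Suc m))"
    by (rule arg_cong)
  then have "real (n choose k) * (real (Suc l) * real (Suc m - l)) = real (m choose l) * (real n * real (Suc m))"
    by (simp only: of_nat_mult)
  moreover have "real (Suc m - l) = real n - real k" "real (Suc m) = real n - 1" "n - 2 = m" "k - 1 = l"
    using l by (auto simp: k n of_nat_diff)
  ultimately show ?thesis
    by (simp only: k)
qed

text \<open>Here \<open>a\<close> and \<open>b\<close> stand for the smaller and the larger of
  \<open>k\<close> and \<open>n - k\<close>. Dropping the \<open>- 1\<close> leaves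
  \<open>(a + b - 2 * i) * b <= (a + b) * (b - i)\<close>, whose slack is
  \<open>i * (b - a)\<close>.\<close>

lemma harmonic_ratio_step:
  fixes a b i :: real
  assumes "0 \<le> i" "i \<le> a" "a \<le> b" "0 < a"
  shows "(1 - i / a) * ((a + b - 2 * i) * (a + b - 2 * i - 1) * (a * b)) \<le> (a + b)\<^sup>2 * ((a - i) * (b - i))"
proof -
  have "(1 - i / a) * ((a + b - 2 * i) * (a + b - 2 * i - 1) * (a * b))
      = (a - i) * ((a + b - 2 * i) * (a + b - 2 * i - 1) * b)"
    using assms by (simp add: field_simps)
  also have "\<dots> \<le> (a - i) * ((a + b - 2 * i) * (a + b) * b)"
    using assms by (intro mult_left_mono mult_right_mono) auto
  also have "(a + b - 2 * i) * b \<le> (a + b) * (b - i)"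
  proof -
    have "0 \<le> i * (b - a)"
      using assms by simp
    then show ?thesis
      by (simp add: algebra_simps)
  qed
  then have "(a - i) * ((a + b - 2 * i) * (a + b) * b) \<le> (a - i) * ((a + b) * ((a + b) * (b - i)))"
    using assms by (intro mult_left_mono) (auto simp: mult_ac)
  finally show ?thesis
    by (simp add: power2_eq_square mult_ac)
qed

lemma binomial_Suc_ratio:
  assumes "s \<le> n"
  shows "real (n choose Suc s) * real (Suc s) = real (n choose s) * (real n - real s)"
proof -
  have "Suc s * (n choose Suc s) = (n - s) * (n choose s)"
    by (simp only: binomial_absorption binomial_absorb_comp)
  then have "real (Suc s * (n choose Suc s)) = real ((n - s) * (n choose s))"
    by (rule arg_cong)
  then show ?thesis
    by (simp only: of_nat_mult of_nat_diff[OF assms] mult_ac)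
qed

text \<open>At \<open>x = kappa\<close>, \<open>A\<close> is
  \<open>\<alpha> ^ 4 + \<beta> ^ 4\<close>, \<open>B\<close> is the hypercontractive constant, and
  the factor \<open>e\<close> per degree is the price of passing from the layer norm to the product
  norm. At \<open>x = 0\<close> the first bound is nearly sharp: \<open>11.56 * e\<close> is about
  31.4, against 32.\<close>

lemma scaled_constant_le:
  fixes x :: real
  defines "A \<equiv> 2 + 4 * x\<^sup>2 + x ^ 4" and "B \<equiv> max 11.56 (1 + 6 * x\<^sup>2)"
  shows "B * exp 1 \<le> 16 * A"
    and "2 \<le> \<bar>x\<bar> \<Longrightarrow> (1 + \<bar>x\<bar> / 5)\<^sup>2 * (B * exp 1) \<le> 16 * A"
proof -
  have e: "exp 1 \<le> (2.72 :: real)"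
    using e_less_272 by simp
  have "B * exp 1 \<le> B * 2.72"
    using e by (intro mult_left_mono) (auto simp: B_def)
  also have "\<dots> \<le> 16 * A"
    by (auto simp: A_def B_def max_def)
  finally show "B * exp 1 \<le> 16 * A" .
  assume x: "2 \<le> \<bar>x\<bar>"
  then have x2: "4 \<le> x\<^sup>2"
    using power_mono[of 2 "\<bar>x\<bar>" 2] by simp
  \<comment> \<open>This and the bound \<open>6.25 * x^2\<close> for \<open>B\<close> below are what
    \<open>\<bar>x\<bar> >= 2\<close> permits: \<open>1 <= 0.5 * \<bar>x\<bar>\<close> and
    \<open>1 <= 0.25 * x^2\<close>.\<close>
  have "1 + \<bar>x\<bar> / 5 \<le> 0.7 * \<bar>x\<bar>"
    using x by simp
  then have "(1 + \<bar>x\<bar> / 5)\<^sup>2 \<le> (0.7 * \<bar>x\<bar>)\<^sup>2"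
    by (intro power_mono) auto
  then have 1: "(1 + \<bar>x\<bar> / 5)\<^sup>2 \<le> 0.49 * x\<^sup>2"
    by (simp add: power_mult_distrib power2_eq_square)
  have "B \<le> 6.25 * x\<^sup>2"
    using x2 by (auto simp: B_def)
  then have 2: "B * exp 1 \<le> (6.25 * x\<^sup>2) * 2.72"
    using e by (intro mult_mono) auto
  have "(1 + \<bar>x\<bar> / 5)\<^sup>2 * (B * exp 1) \<le> (0.49 * x\<^sup>2) * ((6.25 * x\<^sup>2) * 2.72)"
    by (rule mult_mono[OF 1 2]) (auto simp: B_def)
  also have "\<dots> = 8.33 * x ^ 4"
    by (simp add: power2_eq_square power4_eq_xxxx)
  also have "\<dots> \<le> 16 * A"
    using zero_le_power2[of x] zero_le_even_power[of 4 x] by (simp add: A_def)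
  finally show "(1 + \<bar>x\<bar> / 5)\<^sup>2 * (B * exp 1) \<le> 16 * A" .
qed

text \<open>For large \<open>\<bar>x\<bar>\<close> the spare room in
  \<open>scaled_constant_le\<close> absorbs the damping factor. For \<open>\<bar>x\<bar> < 2\<close>
  that factor is at most \<open>exp (16 / 5)\<close>, uniformly in \<open>d\<close>.\<close>

lemma damped_constant_le:
  fixes x :: real and d :: nat
  defines "A \<equiv> 2 + 4 * x\<^sup>2 + x ^ 4" and "B \<equiv> max 11.56 (1 + 6 * x\<^sup>2)"
  assumes d: "1 \<le> d"
  shows "(1 + \<bar>x\<bar> / (5 * real d)) ^ (8 * d) * (B * exp 1) ^ (4 * d) \<le> 28 * (16 * A) ^ (4 * d)"
proof (cases "2 \<le> \<bar>x\<bar>")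
  case True
  have Ann: "0 \<le> A" "0 \<le> B"
    by (auto simp: A_def B_def)
  have "\<bar>x\<bar> / (5 * real d) \<le> \<bar>x\<bar> / 5"
    using d by (intro divide_left_mono) auto
  then have "(1 + \<bar>x\<bar> / (5 * real d)) ^ (8 * d) \<le> (1 + \<bar>x\<bar> / 5) ^ (8 * d)"
    using d by (intro power_mono) auto
  then have "(1 + \<bar>x\<bar> / (5 * real d)) ^ (8 * d) * (B * exp 1) ^ (4 * d)
      \<le> (1 + \<bar>x\<bar> / 5) ^ (8 * d) * (B * exp 1) ^ (4 * d)"
    using Ann by (intro mult_right_mono) auto
  also have "\<dots> = ((1 + \<bar>x\<bar> / 5)\<^sup>2 * (B * exp 1)) ^ (4 * d)"
    by (simp add: power_mult_distrib flip: power_mult)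
  also have "\<dots> \<le> (16 * A) ^ (4 * d)"
    using scaled_constant_le(2)[OF True] Ann unfolding A_def B_def by (intro power_mono) auto
  also have "\<dots> \<le> 28 * (16 * A) ^ (4 * d)"
    using Ann by simp
  finally show ?thesis .
next
  case False
  \<comment> \<open>Fifth powers clear the fractional exponent. The value 28 is small enough that
    \<open>5 * 28 <= 144\<close> in the final constant.\<close>
  have "exp (16 / 5 :: real) ^ 5 = exp 1 ^ 16"
    by (simp flip: exp_of_nat_mult)
  also have "\<dots> \<le> 2.72 ^ 16"
    using e_less_272 by (intro power_mono) auto
  also have "\<dots> \<le> (28 :: real) ^ 5"
    by (simp add: field_simps)
  finally have e: "exp (16 / 5 :: real) \<le> 28"
    by (subst (asm) power_mono_iff) simp_all
  have "(1 + \<bar>x\<bar> / (5 * real d)) ^ (8 * d) \<le> exp (\<bar>x\<bar> / (5 * real d)) ^ (8 * d)"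
    by (intro power_mono) auto
  also have "\<dots> = exp (8 * \<bar>x\<bar> / 5)"
    using d by (simp flip: exp_of_nat_mult)
  also have "\<dots> \<le> exp (16 / 5)"
    using False by simp
  finally have "(1 + \<bar>x\<bar> / (5 * real d)) ^ (8 * d) \<le> 28"
    using e by linarith
  moreover have "(B * exp 1) ^ (4 * d) \<le> (16 * A) ^ (4 * d)"
    using scaled_constant_le(1)[of x] unfolding A_def B_def by (intro power_mono) auto
  ultimately show ?thesis
    by (intro mult_mono) (auto simp: B_def)
qed

subsection \<open>Hypercontractivity for the biased product measure\<close>

text \<open>\<alpha> and -\<beta> are the values of a character at a coordinate equal to
  \<open>+1\<close> and to \<open>-1\<close>, the latter having probability \<open>p\<close>.
  \<open>balance\<close> says that the mean is zero; together with \<open>alpha_beta\<close> it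
  yields variance 1.\<close>

locale biased_cube =
  fixes p \<alpha> \<beta> :: real
  assumes p_pos: "0 < p" and p_less: "p < 1"
    and alpha_pos: "0 < \<alpha>" and beta_pos: "0 < \<beta>"
    and alpha_beta: "\<alpha> * \<beta> = 1" and balance: "(1 - p) * \<alpha> = p * \<beta>"
begin

definition chi :: "'a \<Rightarrow> 'a set \<Rightarrow> real" where
  "chi i X = (if i \<in> X then - \<beta> else \<alpha>)"

definition chis :: "'a set \<Rightarrow> 'a set \<Rightarrow> real" where
  "chis S X = (\<Prod>i\<in>S. chi i X)"

text \<open>The third moment of a single character, measuring the bias; it is also the coefficient
  that reduces squares of characters.\<close>

definition kappa :: real where
  "kappa = \<alpha> - \<beta>"

definition cube_mean :: "'a set \<Rightarrow> ('a set \<Rightarrow> real) \<Rightarrow> real" where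
  "cube_mean N F = (\<Sum>X\<in>Pow N. p ^ card X * (1 - p) ^ card (N - X) * F X)"

definition fourier :: "'a set \<Rightarrow> ('a set \<Rightarrow> real) \<Rightarrow> 'a set \<Rightarrow> real" where
  "fourier N c X = (\<Sum>S\<in>Pow N. c S * chis S X)"

definition degree_le :: "'a set \<Rightarrow> nat \<Rightarrow> ('a set \<Rightarrow> real) \<Rightarrow> bool" where
  "degree_le N d c \<longleftrightarrow> (\<forall>S\<in>Pow N. d < card S \<longrightarrow> c S = 0)"

definition lowdeg :: "'a set \<Rightarrow> nat \<Rightarrow> ('a set \<Rightarrow> real) set" where
  "lowdeg N d = {F. \<exists>c. degree_le N d c \<and> F = fourier N c}"

text \<open>Both values \<alpha> and -\<beta> are roots of
  \<open>t^2 - kappa * t - 1\<close>.\<close>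

lemma chi_square: "chi i X * chi i X = 1 + kappa * chi i X"
  using alpha_beta by (auto simp: chi_def kappa_def algebra_simps)

lemma alpha_squared: "(1 - p) * \<alpha>\<^sup>2 = p" and beta_squared: "p * \<beta>\<^sup>2 = 1 - p"
proof -
  have "(1 - p) * \<alpha>\<^sup>2 = ((1 - p) * \<alpha>) * \<alpha>"
    by (simp add: power2_eq_square)
  also have "\<dots> = p * (\<alpha> * \<beta>)"
    by (simp add: balance)
  finally show "(1 - p) * \<alpha>\<^sup>2 = p"
    by (simp add: alpha_beta)
  have "p * \<beta>\<^sup>2 = (p * \<beta>) * \<beta>"
    by (simp add: power2_eq_square)
  also have "\<dots> = (1 - p) * (\<alpha> * \<beta>)"
    by (simp flip: balance)
  finally show "p * \<beta>\<^sup>2 = 1 - p"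
    by (simp add: alpha_beta)
qed

lemma cube_mean_insert:
  assumes "finite N" "a \<notin> N"
  shows "cube_mean (insert a N) F = cube_mean N (\<lambda>X. (1 - p) * F X + p * F (insert a X))"
proof -
  have 1: "p ^ card X * (1 - p) ^ card (insert a N - X) * F X
      = p ^ card X * (1 - p) ^ card (N - X) * ((1 - p) * F X)" if "X \<in> Pow N" for X
  proof -
    have "insert a N - X = insert a (N - X)"
      using that assms by auto
    then show ?thesis
      using that assms by (simp add: card_insert_disjoint)
  qed
  have 2: "p ^ card (insert a X) * (1 - p) ^ card (insert a N - insert a X) * F (insert a X)
      = p ^ card X * (1 - p) ^ card (N - X) * (p * F (insert a X))" if "X \<in> Pow N" for X
  proof -
    have "insert a N - insert a X = N - X" "a \<notin> X" "finite X"
      using that assms by (auto intro: finite_subset)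
    then show ?thesis
      by simp
  qed
  show ?thesis
    unfolding cube_mean_def sum_Pow_insert[OF assms] distrib_left sum.distrib
    by (intro arg_cong2[of _ _ _ _ "(+)"] sum.cong refl) (use 1 2 in blast)+
qed

lemma chis_insert_left:
  "finite S \<Longrightarrow> a \<notin> S \<Longrightarrow> chis (insert a S) X = chi a X * chis S X"
  by (simp add: chis_def)

lemma chis_insert_right:
  "a \<notin> S \<Longrightarrow> chis S (insert a X) = chis S X"
  unfolding chis_def by (intro prod.cong) (auto simp: chi_def)

lemma fourier_insert_left:
  assumes "finite N" "a \<notin> N"
  shows "fourier (insert a N) c X = fourier N c X + chi a X * fourier N (\<lambda>S. c (insert a S)) X"
proof -
  have "chis (insert a S) X = chi a X * chis S X" if "S \<in> Pow N" for S
    using that assms by (intro chis_insert_left) (auto intro: finite_subset)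
  then show ?thesis
    using assms by (simp add: fourier_def sum_Pow_insert sum_distrib_left mult.left_commute)
qed

lemma fourier_insert_right:
  "a \<notin> N \<Longrightarrow> fourier N c (insert a X) = fourier N c X"
  unfolding fourier_def by (intro sum.cong refl, subst chis_insert_right) auto

lemma cube_mean_cong: "(\<And>X. X \<subseteq> N \<Longrightarrow> F X = G X) \<Longrightarrow> cube_mean N F = cube_mean N G"
  unfolding cube_mean_def by (intro sum.cong) auto

lemma cube_mean_nonneg: "(\<And>X. X \<subseteq> N \<Longrightarrow> 0 \<le> F X) \<Longrightarrow> 0 \<le> cube_mean N F"
  unfolding cube_mean_def using p_pos p_less by (intro sum_nonneg) auto

lemma cube_mean_add: "cube_mean N (\<lambda>X. F X + G X) = cube_mean N F + cube_mean N G"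
  by (simp add: cube_mean_def distrib_left sum.distrib)

lemma cube_mean_scale: "cube_mean N (\<lambda>X. r * F X) = r * cube_mean N F"
  by (simp add: cube_mean_def sum_distrib_left mult_ac)

lemma cube_mean_mono: "(\<And>X. X \<subseteq> N \<Longrightarrow> F X \<le> G X) \<Longrightarrow> cube_mean N F \<le> cube_mean N G"
  unfolding cube_mean_def using p_pos p_less by (intro sum_mono mult_left_mono) auto

lemma cube_mean_mult_squared_le:
  "(cube_mean N (\<lambda>X. F X * G X))\<^sup>2 \<le> cube_mean N (\<lambda>X. (F X)\<^sup>2) * cube_mean N (\<lambda>X. (G X)\<^sup>2)"
proof -
  define w where "w X = p ^ card X * (1 - p) ^ card (N - X)" for X
  have w: "0 \<le> w X" for X
    using p_pos p_less by (simp add: w_def)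
  have "cube_mean N (\<lambda>X. F X * G X) = (\<Sum>X\<in>Pow N. (sqrt (w X) * F X) * (sqrt (w X) * G X))"
    unfolding cube_mean_def
  proof (rule sum.cong, goal_cases)
    case (2 X)
    have "sqrt (w X) * F X * (sqrt (w X) * G X) = (sqrt (w X) * sqrt (w X)) * (F X * G X)"
      by (simp only: mult_ac)
    then show ?case
      using w[of X] by (simp add: w_def[symmetric])
  qed simp
  moreover have "cube_mean N (\<lambda>X. (F X)\<^sup>2) = (\<Sum>X\<in>Pow N. (sqrt (w X) * F X)\<^sup>2)" for F
    unfolding cube_mean_def
    by (intro sum.cong) (use w in \<open>auto simp: w_def[symmetric] power_mult_distrib\<close>)
  ultimately show ?thesis
    using Cauchy_Schwarz_ineq_sum by metis
qed

text \<open>Splitting off one coordinate writes a function as \<open>g + chi a * h\<close> with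
  \<open>g\<close> and \<open>h\<close> independent of \<open>a\<close>; mean 0 and variance 1 of
  \<open>chi a\<close> remove the cross terms.\<close>

lemma parseval:
  assumes "finite N"
  shows "cube_mean N (\<lambda>X. fourier N c X * fourier N e X) = (\<Sum>S\<in>Pow N. c S * e S)"
  using assms
proof (induction N arbitrary: c e rule: finite_induct)
  case empty
  then show ?case
    by (simp add: cube_mean_def fourier_def chis_def)
next
  case (insert a N)
  have alg: "(1 - p) * ((g + \<alpha> * h) * (g' + \<alpha> * h')) + p * ((g + - \<beta> * h) * (g' + - \<beta> * h'))
      = g * g' + h * h'" for g h g' h' :: real
  proof -
    have "(1 - p) * ((g + \<alpha> * h) * (g' + \<alpha> * h')) + p * ((g + - \<beta> * h) * (g' + - \<beta> * h'))
      = g * g' + ((1 - p) * \<alpha> - p * \<beta>) * (g * h' + g' * h)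
         + ((1 - p) * \<alpha>\<^sup>2 + p * \<beta>\<^sup>2) * (h * h')"
      by (simp add: algebra_simps power2_eq_square)
    then show ?thesis
      using balance alpha_squared beta_squared by simp
  qed
  have "cube_mean (insert a N) (\<lambda>X. fourier (insert a N) c X * fourier (insert a N) e X)
      = cube_mean N (\<lambda>X. fourier N c X * fourier N e X
          + fourier N (\<lambda>S. c (insert a S)) X * fourier N (\<lambda>S. e (insert a S)) X)"
    unfolding cube_mean_insert[OF insert.hyps] fourier_insert_left[OF insert.hyps]
  proof (rule cube_mean_cong, goal_cases)
    case (1 X)
    have "chi a X = \<alpha>" "chi a (insert a X) = - \<beta>"
      using 1 insert.hyps by (auto simp: chi_def)
    then show ?case
      by (simp only: fourier_insert_right[OF insert.hyps(2)] alg)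
  qed
  then show ?case
    using insert by (simp add: cube_mean_add sum_Pow_insert)
qed

text \<open>Bonami's induction on the coordinates: in \<open>g + chi a * h\<close> the part
  \<open>h\<close> has one degree less. After the cubic term is absorbed, the mean of the fourth
  power is at most that of \<open>g^4 + 6.8 * g^2 * h^2 + (1 + 6 * kappa^2) * h^4\<close>; the last
  factor is paid for by the degree that \<open>h\<close> lacks.\<close>

lemma hypercontractive_4:
  assumes "finite N" "degree_le N d c" and B: "11.56 \<le> B" "1 + 6 * kappa\<^sup>2 \<le> B"
  shows "cube_mean N (\<lambda>X. fourier N c X ^ 4) \<le> B ^ d * (cube_mean N (\<lambda>X. (fourier N c X)\<^sup>2))\<^sup>2"
  using assms(1,2)
proof (induction N arbitrary: c d rule: finite_induct)
  case empty
  have "1 \<le> B ^ d"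
    using B by (intro one_le_power) auto
  then have "c {} ^ 4 * 1 \<le> c {} ^ 4 * B ^ d"
    by (intro mult_left_mono) auto
  then show ?case
    by (simp add: cube_mean_def fourier_def chis_def mult.commute flip: power_mult)
next
  case (insert a N)
  define g where "g = fourier N c"
  define h where "h = fourier N (\<lambda>S. c (insert a S))"
  define G where "G = cube_mean N (\<lambda>X. (g X)\<^sup>2)"
  define H where "H = cube_mean N (\<lambda>X. (h X)\<^sup>2)"
  have GH: "0 \<le> G" "0 \<le> H"
    unfolding G_def H_def by (intro cube_mean_nonneg; simp)+
  have f: "fourier (insert a N) c X = g X + chi a X * h X" for X
    using insert.hyps by (simp add: fourier_insert_left g_def h_def)
  have gh: "g (insert a X) = g X" "h (insert a X) = h X" for X
    using insert.hyps by (simp_all add: g_def h_def fourier_insert_right)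
  have c: "chi a X = \<alpha>" "chi a (insert a X) = - \<beta>" if "X \<subseteq> N" for X
    using that insert.hyps by (auto simp: chi_def)
  have alg2: "(1 - p) * (x + \<alpha> * y)\<^sup>2 + p * (x + - \<beta> * y)\<^sup>2 = x\<^sup>2 + y\<^sup>2" for x y :: real
  proof -
    have "(1 - p) * (x + \<alpha> * y)\<^sup>2 + p * (x + - \<beta> * y)\<^sup>2
      = x\<^sup>2 + ((1 - p) * \<alpha> - p * \<beta>) * (2 * x * y) + ((1 - p) * \<alpha>\<^sup>2 + p * \<beta>\<^sup>2) * y\<^sup>2"
      by (simp add: algebra_simps power2_eq_square)
    then show ?thesis
      using balance alpha_squared beta_squared by simp
  qed
  have sq: "cube_mean (insert a N) (\<lambda>X. (fourier (insert a N) c X)\<^sup>2) = G + H"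
  proof -
    have "cube_mean (insert a N) (\<lambda>X. (fourier (insert a N) c X)\<^sup>2)
        = cube_mean N (\<lambda>X. (g X)\<^sup>2 + (h X)\<^sup>2)"
      unfolding cube_mean_insert[OF insert.hyps] f gh
      by (rule cube_mean_cong) (simp only: c alg2)
    then show ?thesis
      by (simp add: cube_mean_add G_def H_def)
  qed
  \<comment> \<open>This is the third moment of one character, and \<open>m4\<close> is the fourth;
    both are coefficients in \<open>alg4\<close>.\<close>
  have m3: "(1 - p) * \<alpha> ^ 3 - p * \<beta> ^ 3 = kappa"
  proof -
    have "(1 - p) * \<alpha> ^ 3 - p * \<beta> ^ 3 = ((1 - p) * \<alpha>\<^sup>2) * \<alpha> - (p * \<beta>\<^sup>2) * \<beta>"
      by (simp add: power2_eq_square power3_eq_cube)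
    also have "\<dots> = p * \<alpha> - (1 - p) * \<beta>"
      by (simp only: alpha_squared beta_squared)
    finally show ?thesis
      using balance by (simp add: kappa_def algebra_simps)
  qed
  have m4: "(1 - p) * \<alpha> ^ 4 + p * \<beta> ^ 4 = 1 + kappa\<^sup>2"
  proof -
    have "(1 - p) * \<alpha> ^ 4 + p * \<beta> ^ 4 = ((1 - p) * \<alpha>\<^sup>2) * \<alpha>\<^sup>2 + (p * \<beta>\<^sup>2) * \<beta>\<^sup>2"
      by algebra
    also have "\<dots> = p * \<alpha>\<^sup>2 + (1 - p) * \<beta>\<^sup>2"
      by (simp only: alpha_squared beta_squared)
    also have "\<dots> = \<alpha>\<^sup>2 + \<beta>\<^sup>2 - 1"
      using alpha_squared beta_squared by (simp add: algebra_simps)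
    finally show ?thesis
      using alpha_beta by (simp add: kappa_def power2_diff mult.assoc)
  qed
  have alg4: "(1 - p) * (x + \<alpha> * y) ^ 4 + p * (x + - \<beta> * y) ^ 4
      = x ^ 4 + 6 * (x\<^sup>2 * y\<^sup>2) + 4 * kappa * (x * y ^ 3) + (1 + kappa\<^sup>2) * y ^ 4" for x y :: real
  proof -
    have "(1 - p) * (x + \<alpha> * y) ^ 4 + p * (x + - \<beta> * y) ^ 4
      = x ^ 4 + ((1 - p) * \<alpha> - p * \<beta>) * (4 * x ^ 3 * y)
        + ((1 - p) * \<alpha>\<^sup>2 + p * \<beta>\<^sup>2) * (6 * (x\<^sup>2 * y\<^sup>2))
        + ((1 - p) * \<alpha> ^ 3 - p * \<beta> ^ 3) * (4 * (x * y ^ 3))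
        + ((1 - p) * \<alpha> ^ 4 + p * \<beta> ^ 4) * y ^ 4"
      by algebra
    then show ?thesis
      using balance alpha_squared beta_squared m3 m4 by simp
  qed
  \<comment> \<open>AM-GM with weight 2/5 on the cubic term, so that \<open>11.56 = (3 + 2/5)\<^sup>2\<close>.\<close>
  have young: "4 * kappa * (x * y ^ 3) \<le> 0.8 * (x\<^sup>2 * y\<^sup>2) + 5 * kappa\<^sup>2 * y ^ 4" for x y :: real
  proof -
    have "0 \<le> 5 * ((0.4 * x - kappa * y) * y)\<^sup>2"
      by simp
    also have "\<dots> = 0.8 * (x\<^sup>2 * y\<^sup>2) + 5 * kappa\<^sup>2 * y ^ 4 - 4 * kappa * (x * y ^ 3)"
      by algebra
    finally show ?thesis by simp
  qed
  define P where "P = cube_mean N (\<lambda>X. (g X)\<^sup>2 * (h X)\<^sup>2)"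
  have "cube_mean (insert a N) (\<lambda>X. fourier (insert a N) c X ^ 4)
      \<le> cube_mean N (\<lambda>X. g X ^ 4 + (6.8 * ((g X)\<^sup>2 * (h X)\<^sup>2) + (1 + 6 * kappa\<^sup>2) * h X ^ 4))"
    unfolding cube_mean_insert[OF insert.hyps] f gh
  proof (rule cube_mean_mono, goal_cases)
    case (1 X)
    show ?case
      unfolding c[OF 1] alg4 using young[of "g X" "h X"] by (simp add: algebra_simps)
  qed
  then have main: "cube_mean (insert a N) (\<lambda>X. fourier (insert a N) c X ^ 4)
      \<le> cube_mean N (\<lambda>X. g X ^ 4) + 6.8 * P + (1 + 6 * kappa\<^sup>2) * cube_mean N (\<lambda>X. h X ^ 4)"
    unfolding cube_mean_add cube_mean_scale P_def by linarith
  have g4: "cube_mean N (\<lambda>X. g X ^ 4) \<le> B ^ d * G\<^sup>2"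
    unfolding g_def G_def using insert.prems by (intro insert.IH) (auto simp: degree_le_def)
  show ?case
  proof (cases d)
    case 0
    have "h X = 0" for X
    proof -
      have "c (insert a S) = 0" if "S \<in> Pow N" for S
      proof -
        have "finite (insert a S)"
          using that insert.hyps by (auto intro: finite_subset)
        then have "0 < card (insert a S)"
          by (simp add: card_gt_0_iff)
        moreover have "insert a S \<in> Pow (insert a N)"
          using that by auto
        ultimately show ?thesis
          using insert.prems 0 unfolding degree_le_def by blast
      qed
      then show ?thesis
        by (simp add: h_def fourier_def)
    qed
    then have "P = 0" "cube_mean N (\<lambda>X. h X ^ 4) = 0" "H = 0"
      by (simp_all add: P_def H_def cube_mean_def)
    then show ?thesis
      using main g4 by (simp add: sq)
  next
    case (Suc k)
    have h4: "cube_mean N (\<lambda>X. h X ^ 4) \<le> B ^ k * H\<^sup>2"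
      unfolding h_def H_def
    proof (rule insert.IH, unfold degree_le_def, intro ballI impI)
      fix S assume S: "S \<in> Pow N" "k < card S"
      have "finite S" "a \<notin> S"
        using S insert.hyps by (auto intro: finite_subset)
      then have "d < card (insert a S)"
        using S Suc by simp
      then show "c (insert a S) = 0"
        using S insert.prems unfolding degree_le_def by auto
    qed
    \<comment> \<open>Cauchy-Schwarz leaves the odd power \<open>B ^ (2 * k + 1)\<close>, so
      \<open>P\<close> gains only the square root of \<open>B\<close> over
      \<open>B ^ k * G * H\<close>. As this root is at least 3.4, \<open>6.8 * P\<close> fits under
      the cross term \<open>2 * B ^ d * G * H\<close>.\<close>
    have "P\<^sup>2 \<le> cube_mean N (\<lambda>X. g X ^ 4) * cube_mean N (\<lambda>X. h X ^ 4)"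
      unfolding P_def using cube_mean_mult_squared_le[of N "\<lambda>X. (g X)\<^sup>2" "\<lambda>X. (h X)\<^sup>2"]
      by (simp flip: power_mult)
    also have "\<dots> \<le> (B ^ d * G\<^sup>2) * (B ^ k * H\<^sup>2)"
      using g4 h4 B by (intro mult_mono cube_mean_nonneg) auto
    also have "\<dots> = B * (B ^ k * (G * H))\<^sup>2"
      by (simp add: Suc power2_eq_square power_mult_distrib algebra_simps)
    finally have "11.56 * P\<^sup>2 \<le> 11.56 * (B * (B ^ k * (G * H))\<^sup>2)"
      by simp
    also have "\<dots> \<le> B * (B * (B ^ k * (G * H))\<^sup>2)"
      using B by (intro mult_right_mono) auto
    finally have "(3.4 * P)\<^sup>2 \<le> (B ^ d * (G * H))\<^sup>2"
      by (simp add: Suc power_mult_distrib power2_eq_square algebra_simps)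
    then have P: "3.4 * P \<le> B ^ d * (G * H)"
      using GH B by (intro power2_le_imp_le[of "3.4 * P"]) auto
    have "(1 + 6 * kappa\<^sup>2) * cube_mean N (\<lambda>X. h X ^ 4) \<le> B * (B ^ k * H\<^sup>2)"
      using h4 B by (intro mult_mono cube_mean_nonneg) auto
    then show ?thesis
      using main g4 P by (simp add: sq Suc power2_sum algebra_simps)
  qed
qed

subsection \<open>Functions of bounded degree\<close>

lemma fourier_add: "fourier N (\<lambda>S. c S + e S) X = fourier N c X + fourier N e X"
  by (simp add: fourier_def distrib_right sum.distrib)

lemma fourier_scale: "fourier N (\<lambda>S. r * c S) X = r * fourier N c X"
  by (simp add: fourier_def sum_distrib_left mult.assoc)

lemma lowdegI: "degree_le N d c \<Longrightarrow> (\<And>X. F X = fourier N c X) \<Longrightarrow> F \<in> lowdeg N d"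
  unfolding lowdeg_def by blast

lemma lowdegE:
  assumes "F \<in> lowdeg N d"
  obtains c where "degree_le N d c" "\<And>X. F X = fourier N c X"
  using assms unfolding lowdeg_def by blast

lemma lowdeg_zero: "(\<lambda>X. 0) \<in> lowdeg N d"
  by (rule lowdegI[of _ _ "\<lambda>S. 0"]) (simp_all add: degree_le_def fourier_def)

lemma lowdeg_add:
  assumes "F \<in> lowdeg N d" "G \<in> lowdeg N d"
  shows "(\<lambda>X. F X + G X) \<in> lowdeg N d"
proof -
  obtain c e where "degree_le N d c" "\<And>X. F X = fourier N c X"
    "degree_le N d e" "\<And>X. G X = fourier N e X"
    using assms by (elim lowdegE) blast
  then show ?thesis
    by (intro lowdegI[of _ _ "\<lambda>S. c S + e S"]) (auto simp: degree_le_def fourier_add)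
qed

lemma lowdeg_scale:
  assumes "F \<in> lowdeg N d"
  shows "(\<lambda>X. r * F X) \<in> lowdeg N d"
proof -
  obtain c where "degree_le N d c" "\<And>X. F X = fourier N c X"
    using assms by (elim lowdegE) blast
  then show ?thesis
    by (intro lowdegI[of _ _ "\<lambda>S. r * c S"]) (auto simp: degree_le_def fourier_scale)
qed

lemma lowdeg_mono: "F \<in> lowdeg N d \<Longrightarrow> d \<le> e \<Longrightarrow> F \<in> lowdeg N e"
  by (erule lowdegE, rule lowdegI) (auto simp: degree_le_def)

lemma lowdeg_sum:
  assumes "\<And>i. i \<in> I \<Longrightarrow> F i \<in> lowdeg N d"
  shows "(\<lambda>X. \<Sum>i\<in>I. F i X) \<in> lowdeg N d"
  using assms by (induction I rule: infinite_finite_induct) (auto intro: lowdeg_zero lowdeg_add)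

lemma lowdeg_chis:
  assumes "finite N" "S \<subseteq> N"
  shows "chis S \<in> lowdeg N (card S)"
proof (rule lowdegI)
  show "degree_le N (card S) (\<lambda>T. if T = S then 1 else 0)"
    by (auto simp: degree_le_def)
  show "chis S X = fourier N (\<lambda>T. if T = S then 1 else 0) X" for X
    using assms by (simp add: fourier_def if_distrib[of "\<lambda>x. x * _"] sum.delta' cong: if_cong)
qed

lemma chi_mult_chis:
  assumes "finite S" "i \<in> S"
  shows "chi i X * chis S X = chis (S - {i}) X + kappa * chis S X"
proof -
  have S: "chis S X = chi i X * chis (S - {i}) X"
    using assms unfolding chis_def by (rule prod.remove)
  have "chi i X * chis S X = (chi i X * chi i X) * chis (S - {i}) X"
    by (simp only: S mult.assoc)
  then show ?thesis
    by (simp add: chi_square S algebra_simps)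
qed

lemma lowdeg_mult_span:
  assumes "F \<in> lowdeg N d"
    and "\<And>S. S \<subseteq> N \<Longrightarrow> card S \<le> d \<Longrightarrow> (\<lambda>X. G X * chis S X) \<in> lowdeg N e"
  shows "(\<lambda>X. G X * F X) \<in> lowdeg N e"
proof -
  obtain c where c: "degree_le N d c" "\<And>X. F X = fourier N c X"
    using assms(1) by (elim lowdegE) blast
  have "(\<lambda>X. \<Sum>S\<in>Pow N. c S * (G X * chis S X)) \<in> lowdeg N e"
  proof (rule lowdeg_sum)
    fix S assume S: "S \<in> Pow N"
    show "(\<lambda>X. c S * (G X * chis S X)) \<in> lowdeg N e"
    proof (cases "card S \<le> d")
      case True
      then show ?thesis
        using S by (intro lowdeg_scale assms(2)) auto
    next
      case False
      then have "c S = 0"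
        using c(1) S by (auto simp: degree_le_def)
      then show ?thesis
        by (simp add: lowdeg_zero)
    qed
  qed
  then show ?thesis
    by (simp add: c(2) fourier_def sum_distrib_left mult.left_commute)
qed

text \<open>A repeated coordinate does not raise the degree, since \<open>chi_square\<close> makes
  its square affine in the character again.\<close>

lemma lowdeg_chi_mult:
  assumes "finite N" "i \<in> N" "F \<in> lowdeg N d"
  shows "(\<lambda>X. chi i X * F X) \<in> lowdeg N (Suc d)"
  using assms(3)
proof (rule lowdeg_mult_span)
  fix S assume S: "S \<subseteq> N" "card S \<le> d"
  have fin: "finite S"
    using S assms(1) by (auto intro: finite_subset)
  show "(\<lambda>X. chi i X * chis S X) \<in> lowdeg N (Suc d)"
  proof (cases "i \<in> S")
    case True
    have "chis (S - {i}) \<in> lowdeg N (Suc d)"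
      using S True fin assms by (intro lowdeg_mono[OF lowdeg_chis]) auto
    moreover have "chis S \<in> lowdeg N (Suc d)"
      using S assms by (intro lowdeg_mono[OF lowdeg_chis]) auto
    ultimately show ?thesis
      using True fin by (simp add: chi_mult_chis lowdeg_add lowdeg_scale)
  next
    case False
    have "chis (insert i S) \<in> lowdeg N (Suc d)"
      using S False fin assms by (intro lowdeg_mono[OF lowdeg_chis]) auto
    moreover have "chis (insert i S) = (\<lambda>X. chi i X * chis S X)"
      using False fin by (auto simp: chis_insert_left)
    ultimately show ?thesis
      by simp
  qed
qed

text \<open>The affine form serves the point indicators on a layer as well as polynomials in the
  characters and in the signs.\<close>

lemma lowdeg_prod_affine:
  assumes "finite N" "S \<subseteq> N"
  shows "(\<lambda>X. \<Prod>i\<in>S. u i + v i * chi i X) \<in> lowdeg N (card S)"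
proof -
  have "finite S"
    using assms by (auto intro: finite_subset)
  then show ?thesis
    using assms(2)
  proof (induction S rule: finite_induct)
    case empty
    then show ?case
      using lowdeg_chis[OF assms(1), of "{}"] by (simp add: chis_def[abs_def])
  next
    case (insert i S)
    let ?F = "\<lambda>X. \<Prod>i\<in>S. u i + v i * chi i X"
    have F: "?F \<in> lowdeg N (card S)"
      using insert by auto
    have "(\<lambda>X. u i * ?F X + v i * (chi i X * ?F X)) \<in> lowdeg N (Suc (card S))"
      using insert.prems F assms(1)
      by (intro lowdeg_add lowdeg_scale lowdeg_chi_mult) (auto intro: lowdeg_mono[of ?F N "card S"])
    moreover have "(\<lambda>X. u i * ?F X + v i * (chi i X * ?F X)) = (\<lambda>X. \<Prod>i\<in>insert i S. u i + v i * chi i X)"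
      using insert.hyps by (auto simp: algebra_simps)
    ultimately show ?case
      using insert.hyps by simp
  qed
qed

lemma lowdeg_chis_mult:
  assumes "finite N" "S \<subseteq> N" "F \<in> lowdeg N d"
  shows "(\<lambda>X. chis S X * F X) \<in> lowdeg N (d + card S)"
proof -
  have "finite S"
    using assms by (auto intro: finite_subset)
  then show ?thesis
    using assms(2)
  proof (induction S rule: finite_induct)
    case empty
    then show ?case
      using assms(3) by (simp add: chis_def)
  next
    case (insert i S)
    then have "(\<lambda>X. chi i X * (chis S X * F X)) \<in> lowdeg N (Suc (d + card S))"
      using assms(1) by (intro lowdeg_chi_mult) auto
    then show ?case
      using insert.hyps by (simp add: chis_insert_left mult.assoc)
  qed
qed

lemma lowdeg_mult:
  assumes "finite N" "F \<in> lowdeg N d" "G \<in> lowdeg N e"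
  shows "(\<lambda>X. F X * G X) \<in> lowdeg N (d + e)"
  using assms(3)
proof (rule lowdeg_mult_span)
  fix S assume S: "S \<subseteq> N" "card S \<le> e"
  have "(\<lambda>X. chis S X * F X) \<in> lowdeg N (d + card S)"
    using S assms by (intro lowdeg_chis_mult)
  then show "(\<lambda>X. F X * chis S X) \<in> lowdeg N (d + e)"
    using S by (subst mult.commute) (auto intro: lowdeg_mono)
qed

subsection \<open>Harmonic representatives on a layer\<close>

text \<open>Lagrange interpolation from the indicators of single points.\<close>

lemma layer_interpolation:
  assumes fin: "finite N"
    and "\<And>Z. Z \<in> layer N k \<Longrightarrow> \<exists>I\<in>lowdeg N d. \<forall>X\<in>layer N k. I X = (if X = Z then 1 else 0)"
  shows "\<exists>G\<in>lowdeg N d. \<forall>X\<in>layer N k. G X = F X"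
proof -
  obtain I where I: "\<And>Z. Z \<in> layer N k \<Longrightarrow> I Z \<in> lowdeg N d"
    "\<And>Z X. Z \<in> layer N k \<Longrightarrow> X \<in> layer N k \<Longrightarrow> I Z X = (if X = Z then 1 else 0)"
    using assms(2) by metis
  show ?thesis
  proof
    show "(\<lambda>X. \<Sum>Z\<in>layer N k. F Z * I Z X) \<in> lowdeg N d"
      using I by (intro lowdeg_sum lowdeg_scale)
    show "\<forall>X\<in>layer N k. (\<Sum>Z\<in>layer N k. F Z * I Z X) = F X"
      using finite_layer[OF fin] by (simp add: I(2) if_distrib sum.delta cong: if_cong)
  qed
qed

text \<open>All sets of a layer have equal size, so \<open>X = Z\<close> may be tested as
  \<open>Z \<subseteq> X\<close>, with \<open>k\<close> factors, or as
  \<open>X \<subseteq> Z\<close>, with \<open>card N - k\<close> factors. Hence degrees above this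
  minimum bring no new functions.\<close>

lemma layer_lowdeg:
  assumes fin: "finite N"
  shows "\<exists>G\<in>lowdeg N (min k (card N - k)). \<forall>X\<in>layer N k. G X = F X"
proof -
  have pos: "\<alpha> + \<beta> \<noteq> 0"
    using alpha_pos beta_pos by simp
  have *: "\<exists>G\<in>lowdeg N k. \<forall>X\<in>layer N k. G X = F X"
  proof (rule layer_interpolation[OF fin])
    fix Z assume Z: "Z \<in> layer N k"
    show "\<exists>I\<in>lowdeg N k. \<forall>X\<in>layer N k. I X = (if X = Z then 1 else 0)"
    proof (intro bexI ballI)
      fix X assume X: "X \<in> layer N k"
      \<comment> \<open>The affine factor sends the character value -\<beta> to 1 and \<alpha> to 0,
        so it indicates \<open>i \<in> X\<close>.\<close>
      have "(\<Prod>i\<in>Z. \<alpha> / (\<alpha> + \<beta>) + (- 1 / (\<alpha> + \<beta>)) * chi i X) = (\<Prod>i\<in>Z. if i \<in> X then 1 else 0)"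
        using pos by (intro prod.cong) (auto simp: chi_def add_divide_distrib[symmetric])
      also have "\<dots> = (if Z \<subseteq> X then 1 else 0)"
        using Z fin by (subst prod_indicator) (auto simp: layer_def intro: finite_subset)
      also have "Z \<subseteq> X \<longleftrightarrow> X = Z"
        using X Z fin card_subset_eq[of X Z] by (auto simp: layer_def intro: finite_subset)
      finally show "(\<Prod>i\<in>Z. \<alpha> / (\<alpha> + \<beta>) + (- 1 / (\<alpha> + \<beta>)) * chi i X) = (if X = Z then 1 else 0)" .
    next
      show "(\<lambda>X. \<Prod>i\<in>Z. \<alpha> / (\<alpha> + \<beta>) + (- 1 / (\<alpha> + \<beta>)) * chi i X) \<in> lowdeg N k"
        using lowdeg_prod_affine[OF fin, of Z "\<lambda>_. \<alpha> / (\<alpha> + \<beta>)" "\<lambda>_. - 1 / (\<alpha> + \<beta>)"] Z by (auto simp: layer_def)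
    qed
  qed
  have "\<exists>G\<in>lowdeg N (card N - k). \<forall>X\<in>layer N k. G X = F X"
  proof (rule layer_interpolation[OF fin])
    fix Z assume Z: "Z \<in> layer N k"
    show "\<exists>I\<in>lowdeg N (card N - k). \<forall>X\<in>layer N k. I X = (if X = Z then 1 else 0)"
    proof (intro bexI ballI)
      fix X assume X: "X \<in> layer N k"
      \<comment> \<open>The complementary affine factor, which indicates
        \<open>i \<notin> X\<close>.\<close>
      have "(\<Prod>i\<in>N - Z. \<beta> / (\<alpha> + \<beta>) + (1 / (\<alpha> + \<beta>)) * chi i X) = (\<Prod>i\<in>N - Z. if i \<notin> X then 1 else 0)"
        using pos by (intro prod.cong) (auto simp: chi_def add_divide_distrib[symmetric] add.commute)
      also have "\<dots> = (if X \<subseteq> Z then 1 else 0)"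
        using X Z fin by (subst prod_indicator) (auto simp: layer_def)
      also have "X \<subseteq> Z \<longleftrightarrow> X = Z"
        using X Z fin card_subset_eq[of Z X] by (auto simp: layer_def intro: finite_subset)
      finally show "(\<Prod>i\<in>N - Z. \<beta> / (\<alpha> + \<beta>) + (1 / (\<alpha> + \<beta>)) * chi i X) = (if X = Z then 1 else 0)" .
    next
      have "card (N - Z) = card N - k"
        using Z fin by (auto simp: layer_def intro!: card_Diff_subset intro: finite_subset)
      then show "(\<lambda>X. \<Prod>i\<in>N - Z. \<beta> / (\<alpha> + \<beta>) + (1 / (\<alpha> + \<beta>)) * chi i X) \<in> lowdeg N (card N - k)"
        using lowdeg_prod_affine[OF fin, of "N - Z" "\<lambda>_. \<beta> / (\<alpha> + \<beta>)" "\<lambda>_. 1 / (\<alpha> + \<beta>)"] by auto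
    qed
  qed
  with * show ?thesis
    by (simp add: min_def)
qed

text \<open>With \<open>k = p * n\<close> the total is
  \<open>n * ((1 - p) * \<alpha> - p * \<beta>)\<close>. This is the one linear relation behind all
  degree reductions on the layer.\<close>

lemma sum_chi_layer:
  assumes "finite N" "real k = p * real (card N)" "X \<in> layer N k"
  shows "(\<Sum>i\<in>N. chi i X) = 0"
proof -
  have X: "X \<subseteq> N" "card X = k" "finite X"
    using assms by (auto simp: layer_def intro: finite_subset)
  have kn: "k \<le> card N"
    using X assms(1) card_mono by blast
  have "(\<Sum>i\<in>N. chi i X) = (\<Sum>i\<in>X. chi i X) + (\<Sum>i\<in>N - X. chi i X)"
    using X assms(1) by (simp add: sum.subset_diff[of X N])
  also have "\<dots> = (\<Sum>i\<in>X. - \<beta>) + (\<Sum>i\<in>N - X. \<alpha>)"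
    by (intro arg_cong2[of _ _ _ _ "(+)"] sum.cong) (auto simp: chi_def)
  also have "\<dots> = (real (card N) - real k) * \<alpha> - real k * \<beta>"
    using X kn by (simp add: card_Diff_subset of_nat_diff)
  also have "\<dots> = real (card N) * ((1 - p) * \<alpha> - p * \<beta>)"
    by (simp add: assms(2) algebra_simps)
  finally show ?thesis
    using balance by simp
qed

text \<open>The kernel of the operator that sums coefficients over the sets one element larger. The
  condition at \<open>T\<close> involves only sets of size \<open>card T + 1\<close>, so it
  constrains each homogeneous part separately.\<close>

definition harmonic :: "'a set \<Rightarrow> ('a set \<Rightarrow> real) \<Rightarrow> bool" where
  "harmonic N c \<longleftrightarrow> (\<forall>T\<in>Pow N. (\<Sum>a\<in>N - T. c (insert a T)) = 0)"

text \<open>Multiply the relation of \<open>sum_chi_layer\<close> by \<open>chis T\<close>; the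
  summands with \<open>a \<in> T\<close> reduce by \<open>chi_mult_chis\<close>. A sum in degree
  \<open>card T + 1\<close> is thus expressed in degree at most \<open>card T\<close>.\<close>

lemma sum_chis_insert_layer:
  assumes "finite N" "real k = p * real (card N)" "X \<in> layer N k" "T \<subseteq> N"
  shows "(\<Sum>a\<in>N - T. chis (insert a T) X) = - (\<Sum>a\<in>T. chis (T - {a}) X + kappa * chis T X)"
proof -
  have fin: "finite T"
    using assms by (auto intro: finite_subset)
  have "(\<Sum>a\<in>N - T. chis (insert a T) X) = (\<Sum>a\<in>N - T. chi a X) * chis T X"
    using fin by (auto simp: sum_distrib_right chis_insert_left)
  also have "(\<Sum>a\<in>N - T. chi a X) = - (\<Sum>a\<in>T. chi a X)"
    using sum_chi_layer[OF assms(1-3)] sum.subset_diff[of T N "\<lambda>a. chi a X"] assms by simp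
  finally show ?thesis
    using fin by (simp add: sum_distrib_right chi_mult_chis)
qed

text \<open>Induction on the degree. The top coefficients are projected away from the span of the
  incidence vectors \<open>v T\<close>; the residual is harmonic, and the removed combination has
  lower degree on the layer, where the induction hypothesis applies.\<close>

lemma harmonic_representation:
  assumes fin: "finite N" and k: "real k = p * real (card N)" and "degree_le N d c"
  shows "\<exists>e. degree_le N d e \<and> harmonic N e \<and> (\<forall>X\<in>layer N k. fourier N e X = fourier N c X)"
  using assms(3)
proof (induction d arbitrary: c)
  case 0
  have "c (insert a T) = 0" if "insert a T \<in> Pow N" for a T
  proof -
    have "finite (insert a T)"
      using that fin by (auto intro: finite_subset)
    then have "0 < card (insert a T)"
      by (simp add: card_gt_0_iff)
    then show ?thesis
      using 0 that by (auto simp: degree_le_def)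
  qed
  then have "harmonic N c"
    by (auto simp: harmonic_def intro!: sum.neutral)
  with 0 show ?case by blast
next
  case (Suc d)
  define A where "A = {S \<in> Pow N. card S = Suc d}"
  define J where "J = {T \<in> Pow N. card T = d}"
  \<comment> \<open>Orthogonality to \<open>v T\<close> on \<open>A\<close> is exactly the harmonic
    condition at \<open>T\<close>.\<close>
  define v :: "'a set \<Rightarrow> 'a set \<Rightarrow> real" where "v T S = (if T \<subseteq> S then 1 else 0)" for T S
  have finA: "finite A" and finJ: "finite J"
    using fin by (auto simp: A_def J_def)
  have finT: "finite T" if "T \<subseteq> N" for T
    using that fin by (rule finite_subset)
  obtain e where e: "\<And>T. T \<in> J \<Longrightarrow> (\<Sum>S\<in>A. (c S - (\<Sum>T'\<in>J. e T' * v T' S)) * v T S) = 0"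
    using orthogonal_projection_exists[OF finJ, of c v A] by blast
  define h where "h S = (if card S = Suc d then c S - (\<Sum>T\<in>J. e T * v T S) else 0)" for S
  have shadow: "(\<Sum>S\<in>A. f S * v T S) = (\<Sum>a\<in>N - T. f (insert a T))" if "T \<in> J" for f T
  proof -
    have "(\<Sum>S\<in>A. f S * v T S) = (\<Sum>S | S \<in> Pow N \<and> card S = Suc (card T) \<and> T \<subseteq> S. f S)"
      using that fin by (intro sum.mono_neutral_cong_right) (auto simp: A_def J_def v_def)
    also have "\<dots> = (\<Sum>a\<in>N - T. f (insert a T))"
      using that fin by (intro sum_upper_shadow) (auto simp: J_def)
    finally show ?thesis .
  qed
  have harm_h: "harmonic N h"
    unfolding harmonic_def
  proof
    fix T assume T: "T \<in> Pow N"
    show "(\<Sum>a\<in>N - T. h (insert a T)) = 0"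
    proof (cases "card T = d")
      case True
      then have "T \<in> J"
        using T by (simp add: J_def)
      have "(\<Sum>S\<in>A. h S * v T S) = 0"
        by (subst e[OF \<open>T \<in> J\<close>, symmetric], rule sum.cong) (auto simp: h_def A_def)
      then show ?thesis
        using shadow[OF \<open>T \<in> J\<close>] by simp
    next
      case False
      then show ?thesis
        using T finT by (intro sum.neutral) (auto simp: h_def)
    qed
  qed
  \<comment> \<open>The removed part, rewritten on the layer by
    \<open>sum_chis_insert_layer\<close>.\<close>
  define L where "L X = (\<Sum>T\<in>J. e T * - (\<Sum>a\<in>T. chis (T - {a}) X + kappa * chis T X))" for X
  have "L \<in> lowdeg N d"
  proof -
    have "(\<lambda>X. \<Sum>T\<in>J. (- e T) * (\<Sum>a\<in>T. chis (T - {a}) X + kappa * chis T X)) \<in> lowdeg N d"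
    proof (intro lowdeg_sum lowdeg_scale lowdeg_add)
      fix T a assume "T \<in> J" "a \<in> T"
      then show "chis (T - {a}) \<in> lowdeg N d" "chis T \<in> lowdeg N d"
        using fin finT by (auto simp: J_def intro!: lowdeg_mono[OF lowdeg_chis])
    qed
    then show ?thesis
      unfolding L_def[abs_def] by simp
  qed
  then obtain c2 where c2: "degree_le N d c2" "\<And>X. L X = fourier N c2 X"
    by (elim lowdegE) blast
  define c1 where "c1 S = (if card S \<le> d then c S else 0)" for S
  have split: "fourier N c X = fourier N h X + (fourier N c1 X + fourier N c2 X)"
    if X: "X \<in> layer N k" for X
  proof -
    have "fourier N c X = fourier N (\<lambda>S. h S + c1 S + (if S \<in> A then (\<Sum>T\<in>J. e T * v T S) else 0)) X"
      unfolding fourier_def using Suc.prems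
      by (intro sum.cong refl) (auto simp: h_def c1_def A_def degree_le_def not_le)
    also have "\<dots> = fourier N h X + fourier N c1 X
        + fourier N (\<lambda>S. if S \<in> A then (\<Sum>T\<in>J. e T * v T S) else 0) X"
      by (simp add: fourier_add)
    also have "fourier N (\<lambda>S. if S \<in> A then (\<Sum>T\<in>J. e T * v T S) else 0) X
        = (\<Sum>S\<in>A. (\<Sum>T\<in>J. e T * v T S) * chis S X)"
      unfolding fourier_def using fin
      by (intro sum.mono_neutral_cong_right) (auto simp: A_def)
    also have "\<dots> = (\<Sum>S\<in>A. \<Sum>T\<in>J. e T * (chis S X * v T S))"
      unfolding sum_distrib_right by (intro sum.cong refl) (simp add: mult_ac)
    also have "\<dots> = (\<Sum>T\<in>J. e T * (\<Sum>S\<in>A. chis S X * v T S))"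
      by (subst sum.swap) (simp add: sum_distrib_left)
    also have "\<dots> = (\<Sum>T\<in>J. e T * (\<Sum>a\<in>N - T. chis (insert a T) X))"
      by (simp add: shadow)
    also have "\<dots> = L X"
      unfolding L_def by (intro sum.cong refl, subst sum_chis_insert_layer[OF fin k X]) (auto simp: J_def)
    finally show ?thesis
      by (simp add: c2(2))
  qed
  have "degree_le N d (\<lambda>S. c1 S + c2 S)"
    using c2(1) by (auto simp: degree_le_def c1_def)
  then obtain e' where e': "degree_le N d e'" "harmonic N e'"
    "\<And>X. X \<in> layer N k \<Longrightarrow> fourier N e' X = fourier N (\<lambda>S. c1 S + c2 S) X"
    using Suc.IH by blast
  show ?case
  proof (intro exI[of _ "\<lambda>S. h S + e' S"] conjI ballI)
    show "degree_le N (Suc d) (\<lambda>S. h S + e' S)"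
      using e'(1) by (auto simp: degree_le_def h_def)
    show "harmonic N (\<lambda>S. h S + e' S)"
      using harm_h e'(2) by (auto simp: harmonic_def sum.distrib)
    show "fourier N (\<lambda>S. h S + e' S) X = fourier N c X" if "X \<in> layer N k" for X
      using that by (simp add: split e'(3) fourier_add)
  qed
qed

subsection \<open>Norms of harmonic functions on a layer\<close>

lemma chis_image:
  assumes "bij_betw f N N" "S \<subseteq> N" "X \<subseteq> N"
  shows "chis (f ` S) (f ` X) = chis S X"
proof -
  have inj: "inj_on f N"
    using assms(1) by (simp add: bij_betw_def)
  have "chis (f ` S) (f ` X) = (\<Prod>i\<in>S. chi (f i) (f ` X))"
    unfolding chis_def using inj assms(2) by (subst prod.reindex) (auto intro: inj_on_subset)
  also have "\<dots> = chis S X"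
    unfolding chis_def
  proof (intro prod.cong refl)
    fix i assume "i \<in> S"
    then have "f i \<in> f ` X \<longleftrightarrow> i \<in> X"
      using inj assms by (intro inj_on_image_mem_iff[of f N]) auto
    then show "chi (f i) (f ` X) = chi i X"
      by (simp add: chi_def)
  qed
  finally show ?thesis .
qed

text \<open>Apply a permutation that fixes \<open>T\<close> pointwise and carries \<open>A\<close>
  to \<open>B\<close>.\<close>

lemma layer_mean_chis_exchange:
  assumes fin: "finite N" and T: "T \<subseteq> N" and C: "C \<subseteq> T"
    and A: "A \<subseteq> N - T" and B: "B \<subseteq> N - T" and card: "card A = card B"
  shows "layer_mean N k (\<lambda>X. chis T X * chis (C \<union> A) X) = layer_mean N k (\<lambda>X. chis T X * chis (C \<union> B) X)"
proof -
  obtain f where f: "bij_betw f (N - T) (N - T)" "f ` A = B"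
    using bij_betw_image_exists[of "N - T" A B] assms by auto
  define g where "g x = (if x \<in> T then id x else f x)" for x
  have "bij_betw (\<lambda>x. if x \<in> T then id x else f x) (T \<union> (N - T)) (T \<union> (N - T))"
    by (intro bij_betw_disjoint_Un[OF bij_betw_id f(1)]) auto
  moreover have "T \<union> (N - T) = N"
    using T by auto
  ultimately have g: "bij_betw g N N"
    by (simp only: g_def[abs_def])
  have gT: "g ` T = T"
    by (auto simp: g_def)
  have "g ` C = C" "g ` A = f ` A"
    using C A by (auto simp: g_def intro!: image_cong)
  then have gCA: "g ` (C \<union> A) = C \<union> B"
    by (simp add: image_Un f(2))
  have "layer_mean N k (\<lambda>X. chis T X * chis (C \<union> B) X)
      = layer_mean N k (\<lambda>X. chis (g ` T) (g ` X) * chis (g ` (C \<union> A)) (g ` X))"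
    unfolding gT gCA by (rule layer_mean_permute[OF fin g, symmetric])
  also have "\<dots> = layer_mean N k (\<lambda>X. chis T X * chis (C \<union> A) X)"
  proof (rule layer_mean_cong)
    fix X assume "X \<in> layer N k"
    then have "X \<subseteq> N"
      by (simp add: layer_def)
    moreover have "C \<union> A \<subseteq> N"
      using A C T by auto
    ultimately show "chis (g ` T) (g ` X) * chis (g ` (C \<union> A)) (g ` X) = chis T X * chis (C \<union> A) X"
      using chis_image[OF g] T by simp
  qed
  finally show ?thesis ..
qed

lemma layer_mean_chis_card:
  assumes "finite N" "A \<subseteq> N" "B \<subseteq> N" "card A = card B"
  shows "layer_mean N k (chis A) = layer_mean N k (chis B)"
  using layer_mean_chis_exchange[OF assms(1), of "{}" "{}" A B k] assms by (simp add: chis_def[of "{}"])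

text \<open>Iterates the harmonic condition. Summing over one added element \<open>a\<close> counts
  each \<open>S\<close> once for every element of \<open>S - V\<close>, a fixed positive number,
  while each inner sum vanishes by induction.\<close>

lemma harmonic_sum_supersets:
  assumes fin: "finite N" and harm: "harmonic N c" and "V \<subseteq> N" "card V < i"
  shows "(\<Sum>S | S \<in> layer N i \<and> V \<subseteq> S. c S) = 0"
proof -
  obtain r where "i = Suc (card V + r)"
    using assms(4) less_iff_Suc_add by blast
  then show ?thesis
    using assms(3)
  proof (induction r arbitrary: V)
    case 0
    have "(\<Sum>S | S \<in> layer N i \<and> V \<subseteq> S. c S) = (\<Sum>a\<in>N - V. c (insert a V))"
      using sum_upper_shadow[OF fin 0(2), of c] 0 by (simp add: layer_def conj_assoc)
    then show ?case
      using harm 0 by (simp add: harmonic_def)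
  next
    case (Suc r)
    have finV: "finite V"
      using Suc.prems fin by (auto intro: finite_subset)
    have "real (Suc (Suc r)) * (\<Sum>S | S \<in> layer N i \<and> V \<subseteq> S. c S)
        = (\<Sum>S | S \<in> layer N i \<and> V \<subseteq> S. real (card (S - V)) * c S)"
      unfolding sum_distrib_left using finV Suc.prems
      by (intro sum.cong refl) (simp add: layer_def card_Diff_subset)
    also have "\<dots> = (\<Sum>S | S \<in> layer N i \<and> V \<subseteq> S. \<Sum>a | a \<in> N - V \<and> a \<in> S. c S)"
    proof (intro sum.cong refl)
      fix S assume "S \<in> {S. S \<in> layer N i \<and> V \<subseteq> S}"
      then have "{a. a \<in> N - V \<and> a \<in> S} = S - V"
        by (auto simp: layer_def)
      then show "real (card (S - V)) * c S = (\<Sum>a | a \<in> N - V \<and> a \<in> S. c S)"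
        by simp
    qed
    also have "\<dots> = (\<Sum>a\<in>N - V. \<Sum>S | S \<in> {S. S \<in> layer N i \<and> V \<subseteq> S} \<and> a \<in> S. c S)"
      using fin finite_layer[OF fin, of i] by (intro sum.swap_restrict) auto
    also have "\<dots> = 0"
    proof (rule sum.neutral, rule ballI)
      fix a assume a: "a \<in> N - V"
      have "(\<Sum>S | S \<in> layer N i \<and> insert a V \<subseteq> S. c S) = 0"
        using a Suc.prems finV by (intro Suc.IH) auto
      moreover have "{S. S \<in> {S. S \<in> layer N i \<and> V \<subseteq> S} \<and> a \<in> S} = {S. S \<in> layer N i \<and> insert a V \<subseteq> S}"
        by auto
      ultimately show "(\<Sum>S | S \<in> {S. S \<in> layer N i \<and> V \<subseteq> S} \<and> a \<in> S. c S) = 0"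
        by simp
    qed
    finally show ?case
      by simp
  qed
qed

text \<open>A factor vanishes unless exactly one of \<open>a\<close> and \<open>b a\<close> lies in
  \<open>X\<close>; the two remaining cases give \<open>\<alpha> * (\<alpha> + \<beta>)\<close> and
  \<open>\<beta> * (\<alpha> + \<beta>)\<close>, together \<open>(\<alpha> + \<beta>)^2\<close>.
  Each pair uses one of the \<open>k\<close> elements, and the rest are chosen from
  \<open>M\<close>.\<close>

lemma layer_sum_pairs:
  assumes "finite T" "finite M" "inj_on b T" "b ` T \<inter> T = {}" "M \<inter> (T \<union> b ` T) = {}" "card T \<le> k"
  shows "(\<Sum>X\<in>layer (M \<union> (T \<union> b ` T)) k. \<Prod>a\<in>T. chi a X * (chi a X - chi (b a) X))
    = (\<alpha> + \<beta>) ^ (2 * card T) * real (card M choose (k - card T))"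
  using assms
proof (induction T arbitrary: k rule: finite_induct)
  case empty
  then show ?case
    using card_layer[of M k] by simp
next
  case (insert t T)
  define N where "N = M \<union> (T \<union> b ` T)"
  define F where "F X = (\<Prod>a\<in>T. chi a X * (chi a X - chi (b a) X))" for X
  obtain l where k: "k = Suc l" "card T \<le> l"
    using insert.prems insert.hyps by (cases k) auto
  have N: "finite N" "t \<notin> N" "b t \<notin> N" "b t \<noteq> t"
    using insert.prems insert.hyps by (auto simp: N_def)
  have F: "F (insert t X) = F X" "F (insert (b t) X) = F X" for X
  proof -
    have ne: "a \<noteq> t \<and> a \<noteq> b t \<and> b a \<noteq> t \<and> b a \<noteq> b t" if "a \<in> T" for a
    proof -
      have "a \<in> N" "b a \<in> N"
        using that by (auto simp: N_def)
      then show ?thesis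
        using N(2,3) by metis
    qed
    show "F (insert t X) = F X" "F (insert (b t) X) = F X"
      unfolding F_def by (intro prod.cong refl; use ne in \<open>simp add: chi_def\<close>)+
  qed
  have "(\<Sum>X\<in>layer (M \<union> (insert t T \<union> b ` insert t T)) k.
          \<Prod>a\<in>insert t T. chi a X * (chi a X - chi (b a) X))
      = (\<Sum>X\<in>layer (insert t (insert (b t) N)) (Suc l). (chi t X * (chi t X - chi (b t) X)) * F X)"
    using insert.hyps by (simp add: N_def k F_def insert_commute)
  also have "\<dots> = (\<Sum>X\<in>layer N (Suc l). (chi t X * (chi t X - chi (b t) X)) * F X)
       + (\<Sum>X\<in>layer N l. (chi t (insert (b t) X) * (chi t (insert (b t) X) - chi (b t) (insert (b t) X))) * F X)
       + (\<Sum>X\<in>layer (insert (b t) N) l. (chi t (insert t X) * (chi t (insert t X) - chi (b t) (insert t X))) * F X)"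
    using N by (simp add: layer_insert F)
  also have "(\<Sum>X\<in>layer N (Suc l). (chi t X * (chi t X - chi (b t) X)) * F X) = 0"
    using N by (intro sum.neutral) (auto simp: layer_def chi_def)
  also have "(\<Sum>X\<in>layer N l. (chi t (insert (b t) X) * (chi t (insert (b t) X) - chi (b t) (insert (b t) X))) * F X)
      = \<alpha> * (\<alpha> + \<beta>) * (\<Sum>X\<in>layer N l. F X)"
    unfolding sum_distrib_left using N by (intro sum.cong) (auto simp: layer_def chi_def)
  also have "(\<Sum>X\<in>layer (insert (b t) N) l. (chi t (insert t X) * (chi t (insert t X) - chi (b t) (insert t X))) * F X)
      = (\<Sum>X\<in>layer N l. \<beta> * (\<alpha> + \<beta>) * F X)"
  proof (rule sum.mono_neutral_cong_right)
    show "finite (layer (insert (b t) N) l)"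
      using N by (simp add: finite_layer)
    show "\<forall>X\<in>layer (insert (b t) N) l - layer N l.
        (chi t (insert t X) * (chi t (insert t X) - chi (b t) (insert t X))) * F X = 0"
      by (auto simp: layer_def chi_def)
    show "(chi t (insert t X) * (chi t (insert t X) - chi (b t) (insert t X))) * F X = \<beta> * (\<alpha> + \<beta>) * F X"
      if "X \<in> layer N l" for X
      using that N by (auto simp: layer_def chi_def algebra_simps)
  qed (auto simp: layer_def)
  also have "\<dots> = \<beta> * (\<alpha> + \<beta>) * (\<Sum>X\<in>layer N l. F X)"
    by (simp add: sum_distrib_left)
  also have "(\<Sum>X\<in>layer N l. F X) = (\<alpha> + \<beta>) ^ (2 * card T) * real (card M choose (l - card T))"
    unfolding N_def F_def using insert.prems k by (intro insert.IH) auto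
  finally show ?case
    using insert.hyps k by (simp add: power_add power2_eq_square algebra_simps)
qed

text \<open>The value of \<open>layer_sum_pairs\<close> for \<open>card T = i\<close> and
  \<open>card M = n - 2 * i\<close>, normalised to a mean over the layer.\<close>

definition harmonic_eigenvalue :: "nat \<Rightarrow> nat \<Rightarrow> nat \<Rightarrow> real" where
  "harmonic_eigenvalue n k i = (\<alpha> + \<beta>) ^ (2 * i) * real ((n - 2 * i) choose (k - i)) / real (n choose k)"

text \<open>
  The mean of \<^term>\<open>chis T X * chis S X\<close> depends on \<^term>\<open>S\<close> only through \<^term>\<open>card (S \<inter> T)\<close>, so
  \<^term>\<open>S - T\<close> may be replaced by fresh partners \<^term>\<open>b\<close> of the elements of \<^term>\<open>T - S\<close>.
  Expanding \<open>chi (b a) X + (if a \<in> S then chi a X - chi (b a) X else 0)\<close> over subsets \<open>V\<close> of \<^term>\<open>T\<close>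
  leaves sums of \<^term>\<open>c\<close> over the supersets of \<open>V\<close>, and only \<^term>\<open>V = T\<close> survives.
\<close>

lemma harmonic_gram:
  assumes fin: "finite N" and harm: "harmonic N c" and T: "T \<subseteq> N" "card T \<le> i" "i + card T \<le> card N"
    and ik: "i \<le> k"
  shows "(\<Sum>S\<in>layer N i. c S * layer_mean N k (\<lambda>X. chis T X * chis S X))
    = (if card T = i then c T * harmonic_eigenvalue (card N) k i else 0)"
proof -
  have finT: "finite T"
    using T fin by (auto intro: finite_subset)
  have "i \<le> card (N - T)"
    using T finT by (simp add: card_Diff_subset)
  then obtain U where U: "U \<subseteq> N - T" "card U = i" "finite U"
    by (rule obtain_subset_with_card_n)
  have "card T \<le> card U"
    using U T by simp
  then obtain B where B: "B \<subseteq> U" "card B = card T" "finite B"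
    by (rule obtain_subset_with_card_n)
  obtain b where b: "bij_betw b T B"
    using finite_same_card_bij[of T B] finT B by auto
  \<comment> \<open>Padding: \<open>S - T\<close> has \<open>card (T - S) + (i - card T)\<close>
    elements, so besides the partners of \<open>T - S\<close> it needs \<open>i - card T\<close>
    further fresh points.\<close>
  define E where "E = U - B"
  have E: "E \<subseteq> N - T" "E \<inter> B = {}" "card E = i - card T" "finite E"
    using U B by (auto simp: E_def card_Diff_subset)
  have bT: "b ` T = B" "inj_on b T"
    using b by (auto simp: bij_betw_def)
  define R where "R V X = (\<Prod>a\<in>V. chi a X - chi (b a) X) * (\<Prod>a\<in>T - V. chi (b a) X) * chis E X" for V X
  have exchange: "layer_mean N k (\<lambda>X. chis T X * chis S X)
      = (\<Sum>V\<in>Pow T. (if V \<subseteq> S then layer_mean N k (\<lambda>X. chis T X * R V X) else 0))"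
    if S: "S \<in> layer N i" for S
  proof -
    have SN: "S \<subseteq> N" "card S = i" "finite S"
      using S fin by (auto simp: layer_def intro: finite_subset)
    have "card (S - T) = i - card (S \<inter> T)"
      using SN card_Diff_subset_Int[of S T] by simp
    moreover have "card (b ` (T - S) \<union> E) = card (T - S) + (i - card T)"
    proof -
      have "card (b ` (T - S)) = card (T - S)"
        using bT by (intro card_image) (auto intro: inj_on_subset)
      moreover have "b ` (T - S) \<inter> E = {}"
        using bT E by auto
      ultimately show ?thesis
        using E finT by (simp add: card_Un_disjoint)
    qed
    moreover have "card (T - S) + card (S \<inter> T) = card T"
      using card_Int_Diff[OF finT, of S] by (simp add: Int_commute)
    ultimately have card: "card (S - T) = card (b ` (T - S) \<union> E)"
      using T by simp
    have "layer_mean N k (\<lambda>X. chis T X * chis S X)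
        = layer_mean N k (\<lambda>X. chis T X * chis ((S \<inter> T) \<union> (S - T)) X)"
      by (simp add: Int_Diff_Un)
    also have "\<dots> = layer_mean N k (\<lambda>X. chis T X * chis ((S \<inter> T) \<union> (b ` (T - S) \<union> E)) X)"
      using fin T SN bT B U E card by (intro layer_mean_chis_exchange) auto
    also have "\<dots> = layer_mean N k (\<lambda>X. \<Sum>V\<in>Pow T. (if V \<subseteq> S then chis T X * R V X else 0))"
    proof (rule layer_mean_cong)
      fix X
      have "chis ((S \<inter> T) \<union> (b ` (T - S) \<union> E)) X = chis (S \<inter> T) X * (chis (b ` (T - S)) X * chis E X)"
      proof -
        have "b ` (T - S) \<inter> E = {}" "(S \<inter> T) \<inter> (b ` (T - S) \<union> E) = {}"
          using bT B U E by blast+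
        then show ?thesis
          unfolding chis_def using finT E by (simp add: prod.union_disjoint)
      qed
      also have "\<dots> = (chis (S \<inter> T) X * chis (b ` (T - S)) X) * chis E X"
        by simp
      also have "chis (b ` (T - S)) X = (\<Prod>a\<in>T - S. chi (b a) X)"
        unfolding chis_def using bT by (subst prod.reindex) (auto intro: inj_on_subset)
      also have "chis (S \<inter> T) X * (\<Prod>a\<in>T - S. chi (b a) X)
          = (\<Prod>a\<in>T. if a \<in> S then chi a X else chi (b a) X)"
        unfolding chis_def using finT
        by (simp add: prod.If_cases Int_commute Diff_eq)
      also have "\<dots> = (\<Prod>a\<in>T. (if a \<in> S then chi a X - chi (b a) X else 0) + chi (b a) X)"
        by (intro prod.cong) auto
      also have "\<dots> = (\<Sum>V\<in>Pow T. (\<Prod>a\<in>V. if a \<in> S then chi a X - chi (b a) X else 0)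
           * (\<Prod>a\<in>T - V. chi (b a) X))"
        using finT by (rule prod_add)
      also have "\<dots> = (\<Sum>V\<in>Pow T. if V \<subseteq> S then (\<Prod>a\<in>V. chi a X - chi (b a) X)
           * (\<Prod>a\<in>T - V. chi (b a) X) else 0)"
      proof (intro sum.cong refl)
        fix V assume V: "V \<in> Pow T"
        then have "finite V"
          using finT by (auto intro: finite_subset)
        show "(\<Prod>a\<in>V. if a \<in> S then chi a X - chi (b a) X else 0) * (\<Prod>a\<in>T - V. chi (b a) X)
            = (if V \<subseteq> S then (\<Prod>a\<in>V. chi a X - chi (b a) X) * (\<Prod>a\<in>T - V. chi (b a) X) else 0)"
        proof (cases "V \<subseteq> S")
          case True
          then have "(\<Prod>a\<in>V. if a \<in> S then chi a X - chi (b a) X else 0) = (\<Prod>a\<in>V. chi a X - chi (b a) X)"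
            by (intro prod.cong) auto
          then show ?thesis
            using True by simp
        next
          case False
          then have "(\<Prod>a\<in>V. if a \<in> S then chi a X - chi (b a) X else 0) = 0"
            using \<open>finite V\<close> by (intro prod_zero) auto
          then show ?thesis
            using False by simp
        qed
      qed
      finally have "chis ((S \<inter> T) \<union> (b ` (T - S) \<union> E)) X
          = (\<Sum>V\<in>Pow T. if V \<subseteq> S then R V X else 0)"
        unfolding sum_distrib_right R_def by (auto intro!: sum.cong)
      then show "chis T X * chis ((S \<inter> T) \<union> (b ` (T - S) \<union> E)) X
          = (\<Sum>V\<in>Pow T. (if V \<subseteq> S then chis T X * R V X else 0))"
        unfolding sum_distrib_left by (auto simp: sum_distrib_left intro!: sum.cong)
    qed
    also have "\<dots> = (\<Sum>V\<in>Pow T. (if V \<subseteq> S then layer_mean N k (\<lambda>X. chis T X * R V X) else 0))"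
      unfolding layer_mean_sum by (intro sum.cong refl) (simp add: layer_mean_def)
    finally show ?thesis .
  qed
  have "(\<Sum>S\<in>layer N i. c S * layer_mean N k (\<lambda>X. chis T X * chis S X))
      = (\<Sum>S\<in>layer N i. \<Sum>V\<in>Pow T. (if V \<subseteq> S then c S * layer_mean N k (\<lambda>X. chis T X * R V X) else 0))"
    by (intro sum.cong refl) (auto simp: exchange sum_distrib_left intro!: sum.cong)
  also have "\<dots> = (\<Sum>V\<in>Pow T. \<Sum>S\<in>layer N i. (if V \<subseteq> S then c S * layer_mean N k (\<lambda>X. chis T X * R V X) else 0))"
    by (rule sum.swap)
  also have "\<dots> = (\<Sum>V\<in>Pow T. (\<Sum>S | S \<in> layer N i \<and> V \<subseteq> S. c S) * layer_mean N k (\<lambda>X. chis T X * R V X))"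
    unfolding sum.inter_filter[OF finite_layer[OF fin]] sum_distrib_right
    by (auto intro!: sum.cong)
  also have "\<dots> = (\<Sum>V\<in>{T}. (\<Sum>S | S \<in> layer N i \<and> V \<subseteq> S. c S) * layer_mean N k (\<lambda>X. chis T X * R V X))"
  proof (rule sum.mono_neutral_right)
    show "\<forall>V\<in>Pow T - {T}. (\<Sum>S | S \<in> layer N i \<and> V \<subseteq> S. c S) * layer_mean N k (\<lambda>X. chis T X * R V X) = 0"
    proof
      fix V assume "V \<in> Pow T - {T}"
      then have "V \<subset> T"
        by auto
      then have "card V < card T" "V \<subseteq> N"
        using psubset_card_mono[OF finT] T by auto
      then have "card V < i"
        using T by simp
      then show "(\<Sum>S | S \<in> layer N i \<and> V \<subseteq> S. c S) * layer_mean N k (\<lambda>X. chis T X * R V X) = 0"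
        using harmonic_sum_supersets[OF fin harm \<open>V \<subseteq> N\<close>] by simp
    qed
  qed (use finT in auto)
  also have "\<dots> = (\<Sum>S | S \<in> layer N i \<and> T \<subseteq> S. c S) * layer_mean N k (\<lambda>X. chis T X * R T X)"
    by simp
  also have "\<dots> = (if card T = i then c T * harmonic_eigenvalue (card N) k i else 0)"
  proof (cases "card T = i")
    case True
    have "S = T" if "S \<in> layer N i" "T \<subseteq> S" for S
      using that True fin card_subset_eq[of S T] by (auto simp: layer_def intro: finite_subset)
    then have "{S. S \<in> layer N i \<and> T \<subseteq> S} = {T}"
      using T True by (auto simp: layer_def)
    moreover have "layer_mean N k (\<lambda>X. chis T X * R T X) = harmonic_eigenvalue (card N) k i"
    proof -
      have "E = {}"
        using E True by simp
      then have "layer_mean N k (\<lambda>X. chis T X * R T X)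
          = layer_mean N k (\<lambda>X. \<Prod>a\<in>T. chi a X * (chi a X - chi (b a) X))"
        by (simp add: R_def chis_def prod.distrib)
      also have "\<dots> = (\<Sum>X\<in>layer ((N - (T \<union> b ` T)) \<union> (T \<union> b ` T)) k. \<Prod>a\<in>T. chi a X * (chi a X - chi (b a) X))
          / real (card N choose k)"
      proof -
        have "(N - (T \<union> b ` T)) \<union> (T \<union> b ` T) = N"
          using T bT B U by auto
        then show ?thesis
          by (simp only: layer_mean_def)
      qed
      also have "\<dots> = (\<alpha> + \<beta>) ^ (2 * card T) * real (card (N - (T \<union> b ` T)) choose (k - card T))
          / real (card N choose k)"
        using fin finT bT B U True ik by (subst layer_sum_pairs) auto
      also have "card (N - (T \<union> b ` T)) = card N - 2 * card T"
      proof -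
        have "card (T \<union> B) = 2 * card T"
          using finT B U by (subst card_Un_disjoint) auto
        moreover have "T \<union> B \<subseteq> N"
          using T B U by auto
        ultimately show ?thesis
          using fin finT B by (simp add: bT card_Diff_subset)
      qed
      finally show ?thesis
        by (simp add: harmonic_eigenvalue_def True)
    qed
    ultimately show ?thesis
      using True by simp
  next
    case False
    then show ?thesis
      using harmonic_sum_supersets[OF fin harm, of T i] T by simp
  qed
  finally show ?thesis .
qed

text \<open>The gap \<open>\<alpha> + \<beta>\<close> between the character values is the reciprocal
  of the standard deviation of a \<open>p\<close>-biased bit.\<close>

lemma alpha_beta_variance: "p * (1 - p) * (\<alpha> + \<beta>)\<^sup>2 = 1"
proof -
  have "p * (\<alpha> + \<beta>) = \<alpha>" "(1 - p) * (\<alpha> + \<beta>) = \<beta>"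
    using balance by (simp_all add: algebra_simps)
  then have "(p * (\<alpha> + \<beta>)) * ((1 - p) * (\<alpha> + \<beta>)) = 1"
    using alpha_beta by simp
  then show ?thesis
    by (simp add: power2_eq_square mult_ac)
qed

text \<open>The eigenvalue for \<open>i + 1\<close> is at least \<open>1 - i / m\<close> times that
  for \<open>i\<close>, where \<open>m = min k (n - k)\<close>; the product of these factors is
  handled by \<open>exp_minus_le_falling_ratio\<close>.\<close>

lemma harmonic_eigenvalue_ge:
  assumes k: "real k = p * real n" and i: "i \<le> min k (n - k)"
  shows "exp (- real i) \<le> harmonic_eigenvalue n k i"
proof (cases "i = 0")
  case True
  have "k \<le> n"
  proof -
    have "p * real n \<le> 1 * real n"
      using p_less by (intro mult_right_mono) auto
    then show ?thesis
      using k by simp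
  qed
  then show ?thesis
    using True by (simp add: harmonic_eigenvalue_def)
next
  case False
  define m where "m = min k (n - k)"
  have pos: "0 < k" "k < n" "0 < m"
    using i False by (auto simp: m_def)
  \<comment> \<open>Division-free form of
    \<open>(\<alpha> + \<beta>)^2 = n^2 / (k * (n - k))\<close>.\<close>
  have q: "(\<alpha> + \<beta>)\<^sup>2 * (real k * (real n - real k)) = (real n)\<^sup>2"
  proof -
    have "(\<alpha> + \<beta>)\<^sup>2 * (real k * (real n - real k)) = (p * (1 - p) * (\<alpha> + \<beta>)\<^sup>2) * (real n)\<^sup>2"
      by (simp add: k algebra_simps power2_eq_square)
    then show ?thesis
      by (simp add: alpha_beta_variance)
  qed
  have "real (n choose k) * (\<Prod>j<i. 1 - real j / real m) \<le> (\<alpha> + \<beta>) ^ (2 * i) * real ((n - 2 * i) choose (k - i))"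
    using i
  proof (induction i)
    case 0
    then show ?case by simp
  next
    case (Suc i)
    then have im: "i < k" "i < n - k" "i < m"
      by (auto simp: m_def)
    define n' where "n' = n - 2 * i"
    define k' where "k' = k - i"
    have k': "0 < k'" "k' < n'" and kk: "real k' = real k - real i" "real n' = real n - 2 * real i"
      using im by (auto simp: n'_def k'_def)
    \<comment> \<open>The smaller of \<open>k\<close> and \<open>n - k\<close> has to play the role
      of \<open>a\<close> in \<open>harmonic_ratio_step\<close>.\<close>
    have "(1 - real i / real m) * (real n' * (real n' - 1) * (real k * (real n - real k)))
        \<le> (real n)\<^sup>2 * (real k' * (real n' - real k'))"
    proof (cases "k \<le> n - k")
      case True
      then show ?thesis
        using harmonic_ratio_step[of "real i" "real k" "real n - real k"] im pos
        by (simp add: m_def kk of_nat_diff mult_ac)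
    next
      case False
      then have "real (n - k) \<le> real k" "real (n - k) = real n - real k"
        using pos by (auto simp: of_nat_diff)
      then show ?thesis
        using harmonic_ratio_step[of "real i" "real n - real k" "real k"] im pos False
        by (simp add: m_def kk of_nat_diff mult_ac)
    qed
    also have "(real n)\<^sup>2 * (real k' * (real n' - real k'))
        = (\<alpha> + \<beta>)\<^sup>2 * (real k' * (real n' - real k')) * (real k * (real n - real k))"
      by (simp add: q[symmetric])
    finally have "((1 - real i / real m) * (real n' * (real n' - 1))) * (real k * (real n - real k))
        \<le> ((\<alpha> + \<beta>)\<^sup>2 * (real k' * (real n' - real k'))) * (real k * (real n - real k))"
      by (simp only: mult.assoc)
    moreover have "0 < real k * (real n - real k)"
      using pos by simp
    ultimately have "(1 - real i / real m) * (real n' * (real n' - 1))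
        \<le> (\<alpha> + \<beta>)\<^sup>2 * (real k' * (real n' - real k'))"
      by (simp only: mult_le_cancel_right_pos)
    then have "real (n' choose k') * ((1 - real i / real m) * (real n' * (real n' - 1)))
        \<le> real (n' choose k') * ((\<alpha> + \<beta>)\<^sup>2 * (real k' * (real n' - real k')))"
      by (intro mult_left_mono) auto
    also have "\<dots> = (\<alpha> + \<beta>)\<^sup>2 * (real (n' choose k') * (real k' * (real n' - real k')))"
      by (simp only: mult_ac)
    also have "\<dots> = (\<alpha> + \<beta>)\<^sup>2 * (real ((n' - 2) choose (k' - 1)) * (real n' * (real n' - 1)))"
      by (simp only: binomial_step_two[OF k'])
    finally have "(real (n' choose k') * (1 - real i / real m)) * (real n' * (real n' - 1))
        \<le> ((\<alpha> + \<beta>)\<^sup>2 * real ((n' - 2) choose (k' - 1))) * (real n' * (real n' - 1))"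
      by (simp only: mult.assoc)
    moreover have "0 < real n' * (real n' - 1)"
      using k' by simp
    ultimately have step: "real (n' choose k') * (1 - real i / real m) \<le> (\<alpha> + \<beta>)\<^sup>2 * real ((n' - 2) choose (k' - 1))"
      by (simp only: mult_le_cancel_right_pos)
    have "real (n choose k) * (\<Prod>j<Suc i. 1 - real j / real m)
        = (real (n choose k) * (\<Prod>j<i. 1 - real j / real m)) * (1 - real i / real m)"
      by simp
    also have "\<dots> \<le> ((\<alpha> + \<beta>) ^ (2 * i) * real (n' choose k')) * (1 - real i / real m)"
      using Suc im unfolding n'_def k'_def by (intro mult_right_mono) auto
    also have "\<dots> = (\<alpha> + \<beta>) ^ (2 * i) * (real (n' choose k') * (1 - real i / real m))"
      by simp
    also have "\<dots> \<le> (\<alpha> + \<beta>) ^ (2 * i) * ((\<alpha> + \<beta>)\<^sup>2 * real ((n' - 2) choose (k' - 1)))"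
      using step by (intro mult_left_mono) auto
    also have "\<dots> = (\<alpha> + \<beta>) ^ (2 * Suc i) * real ((n - 2 * Suc i) choose (k - Suc i))"
      by (simp add: n'_def k'_def power_add power2_eq_square)
    finally show ?case .
  qed
  moreover have "real (n choose k) * exp (- real i) \<le> real (n choose k) * (\<Prod>j<i. 1 - real j / real m)"
    using i by (intro mult_left_mono exp_minus_le_falling_ratio) (auto simp: m_def)
  ultimately have "real (n choose k) * exp (- real i) \<le> (\<alpha> + \<beta>) ^ (2 * i) * real ((n - 2 * i) choose (k - i))"
    by linarith
  then show ?thesis
    using pos by (simp add: harmonic_eigenvalue_def pos_le_divide_eq mult.commute)
qed

text \<open>By \<open>harmonic_gram\<close> the quadratic form of the layer is diagonal across
  degrees, with eigenvalues at least \<open>exp (- d)\<close>. The bound on \<open>d\<close> leaves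
  enough room in \<open>N\<close> for the fresh partners used there.\<close>

lemma harmonic_layer_norm_ge:
  assumes fin: "finite N" and k: "real k = p * real (card N)" and deg: "degree_le N d c" "harmonic N c"
    and d: "d \<le> min k (card N - k)"
  shows "exp (- real d) * (\<Sum>S\<in>Pow N. (c S)\<^sup>2) \<le> layer_mean N k (\<lambda>X. (fourier N c X)\<^sup>2)"
proof -
  define g where "g T S = layer_mean N k (\<lambda>X. chis T X * chis S X)" for T S
  define Q where "Q i j = (\<Sum>T\<in>layer N j. c T * (\<Sum>S\<in>layer N i. c S * g T S))" for i j
  have zero: "c S = 0" if "S \<subseteq> N" "d < card S" for S
    using deg that by (auto simp: degree_le_def)
  have gsym: "g T S = g S T" for T S
    by (simp add: g_def mult.commute)
  have Qsym: "Q i j = Q j i" for i j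
    unfolding Q_def sum_distrib_left
    by (subst sum.swap) (simp add: gsym mult_ac)
  have gram: "(\<Sum>S\<in>layer N i. c S * g T S) = (if j = i then c T * harmonic_eigenvalue (card N) k i else 0)"
    if "T \<in> layer N j" "j \<le> i" "i \<le> d" for T i j
    unfolding g_def using that d harmonic_gram[OF fin deg(2), of T i k]
    by (auto simp: layer_def)
  have Qle: "Q i j = (if j = i then harmonic_eigenvalue (card N) k i * (\<Sum>S\<in>layer N i. (c S)\<^sup>2) else 0)"
    if "j \<le> i" "i \<le> d" for i j
    unfolding Q_def using that
    by (auto simp: gram sum_distrib_left power2_eq_square mult_ac)
  \<comment> \<open>\<open>harmonic_gram\<close> covers only \<open>j <= i\<close>; symmetry of the
    form gives the rest.\<close>
  have Q: "Q i j = (if i = j then harmonic_eigenvalue (card N) k i * (\<Sum>S\<in>layer N i. (c S)\<^sup>2) else 0)"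
    if "j \<le> d" "i \<le> d" for i j
  proof (cases "j \<le> i")
    case True
    then show ?thesis
      using Qle that by auto
  next
    case False
    then show ?thesis
      using Qle[of i j] that by (auto simp: Qsym[of i j] Qle)
  qed
  have "layer_mean N k (\<lambda>X. (fourier N c X)\<^sup>2)
      = layer_mean N k (\<lambda>X. \<Sum>T\<in>Pow N. \<Sum>S\<in>Pow N. c T * (c S * (chis T X * chis S X)))"
    by (simp add: fourier_def power2_eq_square sum_product mult_ac)
  also have "\<dots> = (\<Sum>T\<in>Pow N. c T * (\<Sum>S\<in>Pow N. c S * g T S))"
    by (simp add: layer_mean_sum layer_mean_scale sum_distrib_left g_def)
  also have "\<dots> = (\<Sum>T\<in>Pow N. c T * (\<Sum>i\<le>d. \<Sum>S\<in>layer N i. c S * g T S))"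
    by (intro sum.cong refl arg_cong2[of _ _ _ _ "(*)"] sum_Pow_by_card fin) (simp add: zero)
  also have "\<dots> = (\<Sum>j\<le>d. \<Sum>T\<in>layer N j. c T * (\<Sum>i\<le>d. \<Sum>S\<in>layer N i. c S * g T S))"
    by (intro sum_Pow_by_card fin) (simp add: zero)
  also have "\<dots> = (\<Sum>j\<le>d. \<Sum>i\<le>d. Q i j)"
    unfolding Q_def by (intro sum.cong refl) (subst sum.swap, simp add: sum_distrib_left)
  also have "\<dots> = (\<Sum>j\<le>d. harmonic_eigenvalue (card N) k j * (\<Sum>S\<in>layer N j. (c S)\<^sup>2))"
    by (intro sum.cong refl) (simp add: Q sum.delta)
  also have "\<dots> \<ge> (\<Sum>j\<le>d. exp (- real d) * (\<Sum>S\<in>layer N j. (c S)\<^sup>2))"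
  proof (intro sum_mono mult_right_mono sum_nonneg)
    fix j assume "j \<in> {..d}"
    then have "exp (- real d) \<le> exp (- real j)" "j \<le> min k (card N - k)"
      using d by auto
    then show "exp (- real d) \<le> harmonic_eigenvalue (card N) k j"
      using harmonic_eigenvalue_ge[OF k, of j] by linarith
  qed auto
  also have "(\<Sum>j\<le>d. exp (- real d) * (\<Sum>S\<in>layer N j. (c S)\<^sup>2)) = exp (- real d) * (\<Sum>S\<in>Pow N. (c S)\<^sup>2)"
    unfolding sum_distrib_left[symmetric]
    by (intro arg_cong2[of _ _ _ _ "(*)"] refl sum_Pow_by_card[symmetric] fin) (simp add: zero)
  finally show ?thesis .
qed

subsection \<open>Comparison of a layer with the product measure\<close>

text \<open>The binomial weights \<open>b\<close> rise up to \<open>k = p * n\<close> and fall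
  afterwards, so the largest of these \<open>n + 1\<close> numbers with sum 1 sits at
  \<open>k\<close>. Restricting the product mean to the layer costs that weight.\<close>

lemma layer_mean_le_cube_mean:
  assumes fin: "finite N" and k: "real k = p * real (card N)" and kn: "k \<le> card N"
    and G: "\<And>X. X \<subseteq> N \<Longrightarrow> 0 \<le> G X"
  shows "layer_mean N k G \<le> (real (card N) + 1) * cube_mean N G"
proof -
  define n where "n = card N"
  define b where "b j = real (n choose j) * p ^ j * (1 - p) ^ (n - j)" for j
  have b0: "0 \<le> b j" for j
    using p_pos p_less by (simp add: b_def)
  have step: "b (Suc j) * (real (Suc j) * (1 - p)) = b j * ((real n - real j) * p)" if "j < n" for j
  proof -
    have e: "n - j = Suc (n - Suc j)"
      using that by simp
    have "b (Suc j) * (real (Suc j) * (1 - p))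
        = (real (n choose Suc j) * real (Suc j)) * p ^ Suc j * (1 - p) ^ (n - j)"
      unfolding b_def e by (simp add: mult_ac)
    also have "\<dots> = b j * ((real n - real j) * p)"
      using that by (simp only: binomial_Suc_ratio) (simp add: b_def mult_ac)
    finally show ?thesis .
  qed
  have up: "b j \<le> b (Suc j)" if "j < k" for j
  proof -
    have jn: "j < n"
      using that kn by (simp add: n_def)
    have "real (Suc j) \<le> p * real n"
      using that k by (simp add: n_def)
    then have "real (Suc j) * (1 - p) \<le> (real n - real j) * p"
      using p_pos p_less by (simp add: algebra_simps)
    then have "b j * (real (Suc j) * (1 - p)) \<le> b (Suc j) * (real (Suc j) * (1 - p))"
      unfolding step[OF jn] using b0 by (intro mult_left_mono) auto
    then show ?thesis
      using p_less by (simp add: mult_le_cancel_right)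
  qed
  have down: "b (Suc j) \<le> b j" if "k \<le> j" "j < n" for j
  proof -
    have "p * real n \<le> real j"
      using that k by (simp add: n_def)
    then have "(real n - real j) * p \<le> real (Suc j) * (1 - p)"
      using p_pos p_less by (simp add: algebra_simps)
    then have "b (Suc j) * (real (Suc j) * (1 - p)) \<le> b j * (real (Suc j) * (1 - p))"
      unfolding step[OF that(2)] using b0 by (intro mult_left_mono) auto
    then show ?thesis
      using p_less by (simp add: mult_le_cancel_right)
  qed
  have mode: "b j \<le> b k" if "j \<le> n" for j
  proof (cases "j \<le> k")
    case True
    then show ?thesis
      by (induction rule: inc_induct) (use up in force)+
  next
    case False
    then have "k \<le> j" by simp
    then show ?thesis
      using that by (induction rule: dec_induct) (use down in force)+
  qed
  have "1 = (\<Sum>j\<le>n. b j)"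
    using binomial_ring[of p "1 - p" n] by (simp add: b_def)
  also have "\<dots> \<le> (\<Sum>j\<le>n. b k)"
    using mode by (intro sum_mono) auto
  finally have 1: "1 \<le> (real n + 1) * b k"
    by (simp add: add.commute)
  have ch: "0 < real (n choose k)"
    using kn by (simp add: n_def)
  have L: "0 \<le> layer_mean N k G"
    unfolding layer_mean_def using G by (intro divide_nonneg_nonneg sum_nonneg) (auto simp: layer_def)
  have "b k * layer_mean N k G = (\<Sum>X\<in>layer N k. p ^ k * (1 - p) ^ (n - k) * G X)"
    using ch unfolding sum_distrib_left[symmetric] by (simp add: b_def layer_mean_def n_def)
  also have "\<dots> = (\<Sum>X\<in>layer N k. p ^ card X * (1 - p) ^ card (N - X) * G X)"
  proof (intro sum.cong refl)
    fix X assume "X \<in> layer N k"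
    then have "card X = k" "card (N - X) = n - k"
      using fin by (auto simp: layer_def n_def card_Diff_subset finite_subset)
    then show "p ^ k * (1 - p) ^ (n - k) * G X = p ^ card X * (1 - p) ^ card (N - X) * G X"
      by simp
  qed
  also have "\<dots> \<le> cube_mean N G"
    unfolding cube_mean_def using fin G p_pos p_less
    by (intro sum_mono2) (auto simp: layer_def)
  finally have 2: "b k * layer_mean N k G \<le> cube_mean N G" .
  have "layer_mean N k G \<le> ((real n + 1) * b k) * layer_mean N k G"
    using mult_right_mono[OF 1 L] by simp
  also have "\<dots> = (real n + 1) * (b k * layer_mean N k G)"
    by simp
  also have "\<dots> \<le> (real n + 1) * cube_mean N G"
    using 2 by (intro mult_left_mono) auto
  finally show ?thesis
    by (simp add: n_def)
qed

lemma layer_mean_chis_recursion: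
  assumes "finite N" "real k = p * real (card N)" "T \<subseteq> N"
  shows "(\<Sum>a\<in>N - T. layer_mean N k (chis (insert a T)))
    = - (\<Sum>a\<in>T. layer_mean N k (chis (T - {a})) + kappa * layer_mean N k (chis T))"
proof -
  have "(\<Sum>a\<in>N - T. layer_mean N k (chis (insert a T)))
      = layer_mean N k (\<lambda>X. \<Sum>a\<in>N - T. chis (insert a T) X)"
    by (simp add: layer_mean_sum)
  also have "\<dots> = layer_mean N k (\<lambda>X. (- 1) * (\<Sum>a\<in>T. chis (T - {a}) X + kappa * chis T X))"
    using assms by (intro layer_mean_cong) (simp add: sum_chis_insert_layer)
  finally show ?thesis
    by (simp only: layer_mean_scale layer_mean_sum layer_mean_add)
qed

text \<open>Strong induction on \<open>card S = s + 1\<close>. By symmetry the recursion expresses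
  \<open>card N - s\<close> copies of the mean for \<open>S\<close> through \<open>s\<close> means
  at level \<open>s - 1\<close> and \<open>s\<close> multiples by \<open>kappa\<close> of the mean
  at level \<open>s\<close>. Rescaling level \<open>j\<close> by
  \<open>sqrt (card N choose j)\<close> bounds the two total coefficients by 1 and \<theta>, and
  \<open>(1 + \<theta>) ^ s + \<theta> * (1 + \<theta>) ^ s = (1 + \<theta>) ^ Suc
  s\<close>.\<close>

lemma layer_mean_chis_bound:
  assumes fin: "finite N" and k: "real k = p * real (card N)" "k \<le> card N" and \<theta>: "0 \<le> \<theta>"
    and small: "\<And>s. s < L \<Longrightarrow> 2 * s \<le> card N \<and> real s * kappa\<^sup>2 \<le> (real (card N) - real s) * \<theta>\<^sup>2"
    and S: "S \<subseteq> N" "card S \<le> L"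
  shows "sqrt (real (card N choose card S)) * \<bar>layer_mean N k (chis S)\<bar> \<le> (1 + \<theta>) ^ card S"
  using S
proof (induction "card S" arbitrary: S rule: less_induct)
  case less
  define n where "n = card N"
  define \<rho> where "\<rho> S = layer_mean N k (chis S)" for S
  have finS: "finite S"
    using less.prems fin by (auto intro: finite_subset)
  show ?case
  proof (cases "card S")
    case 0
    then have "S = {}"
      using finS by simp
    moreover have "layer_mean N k (chis {}) = 1"
      using fin k by (simp add: layer_mean_def chis_def card_layer)
    ultimately show ?thesis
      by simp
  next
    case (Suc s)
    then obtain a where a: "a \<in> S"
      by fastforce
    define T where "T = S - {a}"
    have T: "T \<subseteq> N" "card T = s" "a \<notin> T" "S = insert a T" "finite T"
      using a less.prems finS Suc by (auto simp: T_def)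
    have sn: "s < n"
      using Suc less.prems(1) fin card_mono[of N S] by (simp add: n_def)
    have sm: "2 * s \<le> n" "real s * kappa\<^sup>2 \<le> (real n - real s) * \<theta>\<^sup>2"
      using small[of s] Suc less.prems by (auto simp: n_def)
    have "(\<Sum>b\<in>N - T. \<rho> (insert b T)) = (\<Sum>b\<in>N - T. \<rho> S)"
      unfolding \<rho>_def using T less.prems fin
      by (intro sum.cong refl layer_mean_chis_card) auto
    also have "\<dots> = (real n - real s) * \<rho> S"
      using T fin sn by (simp add: card_Diff_subset n_def of_nat_diff)
    finally have rec: "(real n - real s) * \<rho> S = - (\<Sum>b\<in>T. \<rho> (T - {b}) + kappa * \<rho> T)"
      using layer_mean_chis_recursion[OF fin k(1) T(1)] by (simp add: \<rho>_def)
    define x where "x = sqrt (real (n choose Suc s))"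
    have x0: "0 \<le> x"
      by (simp add: x_def)
    have M: "1 \<le> 1 + \<theta>"
      using \<theta> by simp
    have T_bound: "sqrt (real (n choose s)) * \<bar>\<rho> T\<bar> \<le> (1 + \<theta>) ^ s"
      using less.hyps[of T] T Suc less.prems by (simp add: n_def \<rho>_def)
    \<comment> \<open>After cross-multiplying binomial ratios this comes down to
      \<open>(n - s + 1) * s <= (n - s) * (s + 1)\<close>, that is,
      \<open>2 * s <= n\<close>.\<close>
    have 1: "(real s * x) * \<bar>\<rho> (T - {b})\<bar> \<le> (real n - real s) * (1 + \<theta>) ^ s" if b: "b \<in> T" for b
    proof -
      have s1: "0 < s"
        using b T by (auto simp: card_gt_0_iff)
      then obtain r where r: "s = Suc r"
        using gr0_implies_Suc by blast
      have "sqrt (real (n choose r)) * \<bar>\<rho> (T - {b})\<bar> \<le> (1 + \<theta>) ^ r"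
        using less.hyps[of "T - {b}"] T Suc less.prems b r by (auto simp: n_def \<rho>_def)
      also have "\<dots> \<le> (1 + \<theta>) ^ s"
        using M r by (intro power_increasing) auto
      finally have *: "sqrt (real (n choose r)) * \<bar>\<rho> (T - {b})\<bar> \<le> (1 + \<theta>) ^ s" .
      have c1: "real (n choose Suc s) * (real s + 1) = real (n choose s) * (real n - real s)"
        using binomial_Suc_ratio[of s n] sn by (simp add: add.commute)
      have c2: "real (n choose s) * real s = real (n choose r) * (real n - real s + 1)"
        using binomial_Suc_ratio[of r n] sn r by simp
      have "(real (n choose Suc s) * (real s)\<^sup>2) * (real s + 1)
          = (real (n choose Suc s) * (real s + 1)) * (real s)\<^sup>2"
        by simp
      also have "\<dots> = (real (n choose s) * real s) * ((real n - real s) * real s)"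
        unfolding c1 by (simp add: power2_eq_square)
      also have "\<dots> = (real (n choose r) * (real n - real s)) * ((real n - real s + 1) * real s)"
        unfolding c2 by simp
      also have "\<dots> \<le> (real (n choose r) * (real n - real s)) * ((real n - real s) * (real s + 1))"
      proof (intro mult_left_mono)
        show "(real n - real s + 1) * real s \<le> (real n - real s) * (real s + 1)"
          using sm(1) by (simp add: algebra_simps)
      qed (use sn in auto)
      also have "\<dots> = ((real n - real s)\<^sup>2 * real (n choose r)) * (real s + 1)"
        by (simp add: power2_eq_square)
      finally have "real (n choose Suc s) * (real s)\<^sup>2 \<le> (real n - real s)\<^sup>2 * real (n choose r)"
        by (rule mult_right_le_imp_le) simp
      then have "(real s * x)\<^sup>2 \<le> ((real n - real s) * sqrt (real (n choose r)))\<^sup>2"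
        by (simp add: x_def power_mult_distrib mult.commute)
      then have "real s * x \<le> (real n - real s) * sqrt (real (n choose r))"
        using sn by (intro power2_le_imp_le[of "real s * x"]) auto
      then have "(real s * x) * \<bar>\<rho> (T - {b})\<bar> \<le> ((real n - real s) * sqrt (real (n choose r))) * \<bar>\<rho> (T - {b})\<bar>"
        by (intro mult_right_mono) auto
      also have "\<dots> \<le> (real n - real s) * (1 + \<theta>) ^ s"
        using * sn unfolding mult.assoc by (intro mult_left_mono) auto
      finally show ?thesis .
    qed
    have 2: "(real s * x) * \<bar>kappa * \<rho> T\<bar> \<le> (real n - real s) * (\<theta> * (1 + \<theta>) ^ s)"
    proof -
      have c1: "real (n choose Suc s) * (real s + 1) = real (n choose s) * (real n - real s)"
        using binomial_Suc_ratio[of s n] sn by (simp add: add.commute)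
      have "(real (n choose Suc s) * (real s)\<^sup>2 * kappa\<^sup>2) * (real s + 1)
          = (real (n choose Suc s) * (real s + 1)) * (real s * (real s * kappa\<^sup>2))"
        by (simp add: power2_eq_square)
      also have "real s * (real s * kappa\<^sup>2) \<le> (real s + 1) * ((real n - real s) * \<theta>\<^sup>2)"
        by (rule mult_mono[OF _ sm(2)]) auto
      then have "(real (n choose Suc s) * (real s + 1)) * (real s * (real s * kappa\<^sup>2))
          \<le> (real (n choose Suc s) * (real s + 1)) * ((real s + 1) * ((real n - real s) * \<theta>\<^sup>2))"
        by (intro mult_left_mono) auto
      also have "\<dots> = (real (n choose s) * (real n - real s)\<^sup>2 * \<theta>\<^sup>2) * (real s + 1)"
        unfolding c1 by (simp add: power2_eq_square)
      finally have "real (n choose Suc s) * (real s)\<^sup>2 * kappa\<^sup>2 \<le> real (n choose s) * (real n - real s)\<^sup>2 * \<theta>\<^sup>2"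
        by (rule mult_right_le_imp_le) simp
      then have "(real s * x * \<bar>kappa\<bar>)\<^sup>2 \<le> ((real n - real s) * \<theta> * sqrt (real (n choose s)))\<^sup>2"
        by (simp add: x_def power_mult_distrib mult_ac)
      then have "real s * x * \<bar>kappa\<bar> \<le> (real n - real s) * \<theta> * sqrt (real (n choose s))"
        using sn \<theta> by (intro power2_le_imp_le[of "real s * x * \<bar>kappa\<bar>"]) auto
      then have "(real s * x * \<bar>kappa\<bar>) * \<bar>\<rho> T\<bar> \<le> ((real n - real s) * \<theta> * sqrt (real (n choose s))) * \<bar>\<rho> T\<bar>"
        by (intro mult_right_mono) auto
      also have "\<dots> = (real n - real s) * (\<theta> * (sqrt (real (n choose s)) * \<bar>\<rho> T\<bar>))"
        by simp
      also have "\<dots> \<le> (real n - real s) * (\<theta> * (1 + \<theta>) ^ s)"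
        using T_bound sn \<theta> by (intro mult_left_mono) auto
      finally show ?thesis
        by (simp add: abs_mult mult_ac)
    qed
    \<comment> \<open>The estimates carry a factor \<open>real s\<close> to match the
      \<open>s\<close> summands. It cannot be cancelled for \<open>s = 0\<close>, but there the
      recursion gives \<open>\<rho> S = 0\<close> directly.\<close>
    have main: "(real n - real s) * (x * \<bar>\<rho> S\<bar>) \<le> (real n - real s) * (1 + \<theta>) ^ Suc s"
    proof (cases "s = 0")
      case True
      then have "T = {}"
        using T by simp
      then have "\<rho> S = 0"
        using rec sn by simp
      then show ?thesis
        using sn \<theta> by simp
    next
      case False
      have "(real n - real s) * \<bar>\<rho> S\<bar> = \<bar>(real n - real s) * \<rho> S\<bar>"
        using sn by (simp add: abs_mult)
      also have "\<dots> \<le> (\<Sum>b\<in>T. \<bar>\<rho> (T - {b}) + kappa * \<rho> T\<bar>)"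
        unfolding rec abs_minus_cancel by (rule sum_abs)
      also have "\<dots> \<le> (\<Sum>b\<in>T. \<bar>\<rho> (T - {b})\<bar> + \<bar>kappa * \<rho> T\<bar>)"
        by (intro sum_mono abs_triangle_ineq)
      finally have "(real s * x) * ((real n - real s) * \<bar>\<rho> S\<bar>)
          \<le> (real s * x) * (\<Sum>b\<in>T. \<bar>\<rho> (T - {b})\<bar> + \<bar>kappa * \<rho> T\<bar>)"
        using x0 by (intro mult_left_mono) auto
      also have "\<dots> = (\<Sum>b\<in>T. (real s * x) * \<bar>\<rho> (T - {b})\<bar> + (real s * x) * \<bar>kappa * \<rho> T\<bar>)"
        by (simp only: sum_distrib_left distrib_left)
      also have "\<dots> \<le> (\<Sum>b\<in>T. (real n - real s) * (1 + \<theta>) ^ s + (real n - real s) * (\<theta> * (1 + \<theta>) ^ s))"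
        using 1 2 by (intro sum_mono add_mono) auto
      also have "\<dots> = real s * ((real n - real s) * (1 + \<theta>) ^ Suc s)"
        by (simp add: T algebra_simps)
      finally have "real s * ((real n - real s) * (x * \<bar>\<rho> S\<bar>)) \<le> real s * ((real n - real s) * (1 + \<theta>) ^ Suc s)"
        by (simp only: mult_ac)
      then show ?thesis
        using False by (simp only: mult_le_cancel_left) auto
    qed
    then have "x * \<bar>\<rho> S\<bar> \<le> (1 + \<theta>) ^ Suc s"
      using sn by (simp add: mult_le_cancel_left_pos)
    then show ?thesis
      by (simp add: x_def \<rho>_def n_def Suc)
  qed
qed

text \<open>The layer mean is a linear functional of the coefficients; Cauchy-Schwarz bounds it by
  its values on the characters, and \<open>parseval\<close> identifies the other factor.\<close>

lemma lowdeg_layer_mean_le: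
  assumes fin: "finite N" and h: "h \<in> lowdeg N D"
  shows "(layer_mean N k h)\<^sup>2 \<le> (\<Sum>i\<le>D. \<Sum>S\<in>layer N i. (layer_mean N k (chis S))\<^sup>2) * cube_mean N (\<lambda>X. (h X)\<^sup>2)"
proof -
  obtain c where c: "degree_le N D c" "\<And>X. h X = fourier N c X"
    using h by (elim lowdegE) blast
  define r where "r S = (if card S \<le> D then layer_mean N k (chis S) else 0)" for S
  have "layer_mean N k h = layer_mean N k (\<lambda>X. \<Sum>S\<in>Pow N. c S * chis S X)"
    by (simp add: c(2) fourier_def cong: layer_mean_cong)
  also have "\<dots> = (\<Sum>S\<in>Pow N. c S * layer_mean N k (chis S))"
    by (simp add: layer_mean_sum layer_mean_scale)
  also have "\<dots> = (\<Sum>S\<in>Pow N. r S * c S)"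
    using c(1) by (intro sum.cong refl) (auto simp: r_def degree_le_def)
  finally have "(layer_mean N k h)\<^sup>2 \<le> (\<Sum>S\<in>Pow N. (r S)\<^sup>2) * (\<Sum>S\<in>Pow N. (c S)\<^sup>2)"
    using Cauchy_Schwarz_ineq_sum[of r c "Pow N"] by simp
  also have "(\<Sum>S\<in>Pow N. (c S)\<^sup>2) = cube_mean N (\<lambda>X. (h X)\<^sup>2)"
    using parseval[OF fin, of c c] by (simp add: c(2) power2_eq_square)
  also have "(\<Sum>S\<in>Pow N. (r S)\<^sup>2) = (\<Sum>i\<le>D. \<Sum>S\<in>layer N i. (r S)\<^sup>2)"
    by (rule sum_Pow_by_card[OF fin]) (simp add: r_def)
  also have "\<dots> = (\<Sum>i\<le>D. \<Sum>S\<in>layer N i. (layer_mean N k (chis S))\<^sup>2)"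
    by (intro sum.cong refl) (auto simp: r_def layer_def)
  finally show ?thesis .
qed

text \<open>Degree \<open>i\<close> has \<open>card N choose i\<close> characters, each with squared
  mean at most \<open>(1 + \<theta>) ^ (2 * D)\<close> over that number, so each of the
  \<open>D + 1\<close> degrees contributes at most \<open>(1 + \<theta>) ^ (2 * D)\<close>.\<close>

lemma lowdeg_layer_mean_le_damped:
  assumes fin: "finite N" and k: "real k = p * real (card N)" "k \<le> card N" and \<theta>: "0 \<le> \<theta>"
    and small: "\<And>s. s < D \<Longrightarrow> 2 * s \<le> card N \<and> real s * kappa\<^sup>2 \<le> (real (card N) - real s) * \<theta>\<^sup>2"
    and h: "h \<in> lowdeg N D"
  shows "(layer_mean N k h)\<^sup>2 \<le> ((real D + 1) * (1 + \<theta>) ^ (2 * D)) * cube_mean N (\<lambda>X. (h X)\<^sup>2)"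
proof -
  have "(\<Sum>i\<le>D. \<Sum>S\<in>layer N i. (layer_mean N k (chis S))\<^sup>2) \<le> (\<Sum>i\<le>D. (1 + \<theta>) ^ (2 * D))"
  proof (rule sum_mono)
    fix i assume i: "i \<in> {..D}"
    show "(\<Sum>S\<in>layer N i. (layer_mean N k (chis S))\<^sup>2) \<le> (1 + \<theta>) ^ (2 * D)"
    \<comment> \<open>The binomial vanishes for \<open>i > card N\<close>, where the layer is
      empty.\<close>
    proof (cases "card N choose i = 0")
      case True
      then have "card (layer N i) = 0"
        using card_layer[OF fin, of i] by simp
      then have "layer N i = {}"
        using finite_layer[OF fin, of i] by simp
      then show ?thesis
        using \<theta> by simp
    next
      case False
      have "(layer_mean N k (chis S))\<^sup>2 \<le> (1 + \<theta>) ^ (2 * D) / real (card N choose i)" if S: "S \<in> layer N i" for S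
      proof -
        have "sqrt (real (card N choose i)) * \<bar>layer_mean N k (chis S)\<bar> \<le> (1 + \<theta>) ^ i"
          using layer_mean_chis_bound[OF fin k \<theta> small, of D S] S i by (auto simp: layer_def)
        also have "\<dots> \<le> (1 + \<theta>) ^ D"
          using i \<theta> by (intro power_increasing) auto
        finally have "(sqrt (real (card N choose i)) * \<bar>layer_mean N k (chis S)\<bar>)\<^sup>2 \<le> ((1 + \<theta>) ^ D)\<^sup>2"
          by (intro power_mono) auto
        then have "real (card N choose i) * (layer_mean N k (chis S))\<^sup>2 \<le> (1 + \<theta>) ^ (2 * D)"
          by (simp add: power_mult_distrib mult.commute flip: power_mult)
        then show ?thesis
          using False by (simp add: field_simps)
      qed
      then have "(\<Sum>S\<in>layer N i. (layer_mean N k (chis S))\<^sup>2)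
          \<le> (\<Sum>S\<in>layer N i. (1 + \<theta>) ^ (2 * D) / real (card N choose i))"
        by (intro sum_mono)
      also have "\<dots> = (1 + \<theta>) ^ (2 * D)"
        using False by (simp add: card_layer[OF fin])
      finally show ?thesis .
    qed
  qed
  also have "\<dots> = (real D + 1) * (1 + \<theta>) ^ (2 * D)"
    by simp
  finally show ?thesis
    using lowdeg_layer_mean_le[OF fin h, of k]
    by (meson cube_mean_nonneg mult_right_mono order_trans zero_le_power2)
qed

section \<open>The fourth-moment inequality on a layer\<close>

text \<open>Identifies the base of the target constant with \<open>A\<close> of the numerical
  estimates at \<open>x = kappa\<close>.\<close>

lemma alpha_beta_fourth: "\<alpha> ^ 4 + \<beta> ^ 4 = 2 + 4 * kappa\<^sup>2 + kappa ^ 4"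
proof -
  have "\<alpha> ^ 4 + \<beta> ^ 4 = 2 * (\<alpha> * \<beta>)\<^sup>2 + 4 * (\<alpha> * \<beta>) * kappa\<^sup>2 + kappa ^ 4"
    unfolding kappa_def by algebra
  then show ?thesis
    by (simp add: alpha_beta)
qed

text \<open>Apply \<open>hypercontractive_4\<close> to \<open>F^2\<close>, of degree
  \<open>2 * d\<close>, and then to \<open>F\<close>; the exponents of \<open>B\<close> add up to
  \<open>2 * d + 2 * d\<close>.\<close>

lemma hypercontractive_8:
  assumes fin: "finite N" and F: "F \<in> lowdeg N d" and B: "11.56 \<le> B" "1 + 6 * kappa\<^sup>2 \<le> B"
  shows "cube_mean N (\<lambda>X. F X ^ 8) \<le> B ^ (4 * d) * cube_mean N (\<lambda>X. (F X)\<^sup>2) ^ 4"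
proof -
  have h4: "cube_mean N (\<lambda>X. G X ^ 4) \<le> B ^ e * (cube_mean N (\<lambda>X. (G X)\<^sup>2))\<^sup>2" if G: "G \<in> lowdeg N e" for G e
    using G by (elim lowdegE) (simp add: hypercontractive_4[OF fin _ B])
  have "(\<lambda>X. F X * F X) \<in> lowdeg N (d + d)"
    by (rule lowdeg_mult[OF fin F F])
  from h4[OF this] have "cube_mean N (\<lambda>X. F X ^ 8) \<le> B ^ (d + d) * (cube_mean N (\<lambda>X. F X ^ 4))\<^sup>2"
    by (simp add: power_mult_distrib flip: power_add power2_eq_square power_mult)
  also have "\<dots> \<le> B ^ (d + d) * (B ^ d * (cube_mean N (\<lambda>X. (F X)\<^sup>2))\<^sup>2)\<^sup>2"
    using B h4[OF F] by (intro mult_left_mono power_mono cube_mean_nonneg) auto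
  also have "\<dots> = B ^ (4 * d) * cube_mean N (\<lambda>X. (F X)\<^sup>2) ^ 4"
    by (simp add: power_mult_distrib flip: power_add power_mult mult.assoc)
  finally show ?thesis .
qed

text \<open>The squared layer mean of \<open>F^4\<close> is at most \<open>W\<close> times the
  product mean of \<open>F^8\<close>, hence at most \<open>W * B ^ (4 * d) * Q ^ 4\<close>, and
  \<open>harmonic_layer_norm_ge\<close> trades \<open>Q\<close> for \<open>exp d * L\<close>. What
  remains is to fit \<open>W * (B * e) ^ (4 * d)\<close> under the stated constant.\<close>

lemma harmonic_layer_hypercontractive:
  assumes fin: "finite N" and k: "real k = p * real (card N)" "k \<le> card N" and d: "1 \<le> d" "d \<le> min k (card N - k)"
    and c: "degree_le N d c" "harmonic N c"
  shows "(layer_mean N k (\<lambda>X. fourier N c X ^ 4))\<^sup>2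
    \<le> 144 * real d ^ 3 * (16 * (\<alpha> ^ 4 + \<beta> ^ 4)) ^ (4 * d) * (layer_mean N k (\<lambda>X. (fourier N c X)\<^sup>2)) ^ 4"
proof -
  define n where "n = card N"
  define A where "A = \<alpha> ^ 4 + \<beta> ^ 4"
  define B where "B = max 11.56 (1 + 6 * kappa\<^sup>2)"
  define F where "F = fourier N c"
  define Q where "Q = cube_mean N (\<lambda>X. (F X)\<^sup>2)"
  define L where "L = layer_mean N k (\<lambda>X. (F X)\<^sup>2)"
  have A: "A = 2 + 4 * kappa\<^sup>2 + kappa ^ 4"
    by (simp add: A_def alpha_beta_fourth)
  have B: "11.56 \<le> B" "1 + 6 * kappa\<^sup>2 \<le> B"
    by (auto simp: B_def)
  have nn: "0 \<le> Q" "0 \<le> L" "0 \<le> A" "0 \<le> B"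
    unfolding Q_def L_def A_def using B by (auto intro: cube_mean_nonneg layer_mean_nonneg)
  have F: "F \<in> lowdeg N d"
    using c(1) by (intro lowdegI) (auto simp: F_def)
  have "Q = (\<Sum>S\<in>Pow N. (c S)\<^sup>2)"
    using parseval[OF fin, of c c] by (simp add: Q_def F_def power2_eq_square)
  then have "exp (- real d) * Q \<le> L"
    using harmonic_layer_norm_ge[OF fin k(1) c d(2)] by (simp add: L_def F_def)
  then have QL: "Q \<le> exp (real d) * L"
    by (simp add: exp_minus field_simps)
  have F8: "cube_mean N (\<lambda>X. (F X ^ 4)\<^sup>2) \<le> B ^ (4 * d) * Q ^ 4"
    using hypercontractive_8[OF fin F B] by (simp add: Q_def flip: power_mult)
  have F4: "(\<lambda>X. F X ^ 4) \<in> lowdeg N (4 * d)"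
  proof -
    have "(\<lambda>X. (F X * F X) * (F X * F X)) \<in> lowdeg N ((d + d) + (d + d))"
      by (intro lowdeg_mult fin F)
    moreover have "(d + d) + (d + d) = 4 * d"
      by simp
    ultimately show ?thesis
      by (simp only: power4_eq_xxxx mult.assoc)
  qed
  have e4: "exp (real d) ^ 4 = exp 1 ^ (4 * d)"
    using exp_of_nat_mult[of d "1 :: real"] by (simp add: mult.commute flip: power_mult)
  \<comment> \<open>Isolates that numerical task, since \<open>W\<close> is chosen differently for
    small and for large \<open>n\<close>.\<close>
  have bound: "W * (B * exp 1) ^ (4 * d) \<le> 144 * real d ^ 3 * (16 * A) ^ (4 * d) \<Longrightarrow>
      (layer_mean N k (\<lambda>X. F X ^ 4))\<^sup>2 \<le> 144 * real d ^ 3 * (16 * A) ^ (4 * d) * L ^ 4"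
    if W: "0 \<le> W" "(layer_mean N k (\<lambda>X. F X ^ 4))\<^sup>2 \<le> W * cube_mean N (\<lambda>X. (F X ^ 4)\<^sup>2)" for W
  proof -
    assume num: "W * (B * exp 1) ^ (4 * d) \<le> 144 * real d ^ 3 * (16 * A) ^ (4 * d)"
    have "(layer_mean N k (\<lambda>X. F X ^ 4))\<^sup>2 \<le> W * (B ^ (4 * d) * Q ^ 4)"
      using W(2) mult_left_mono[OF F8 W(1)] by linarith
    also have "\<dots> \<le> W * (B ^ (4 * d) * (exp (real d) * L) ^ 4)"
      using W nn QL by (intro mult_left_mono power_mono) auto
    also have "\<dots> = (W * (B * exp 1) ^ (4 * d)) * L ^ 4"
      by (simp add: power_mult_distrib e4 mult_ac)
    also have "\<dots> \<le> (144 * real d ^ 3 * (16 * A) ^ (4 * d)) * L ^ 4"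
      using num nn by (intro mult_right_mono) auto
    finally show ?thesis .
  qed
  have d3: "1 \<le> real d ^ 3" "real d \<le> real d ^ 3" "(real d)\<^sup>2 * real d = real d ^ 3"
    using d(1) power_increasing[of 1 3 "real d"] one_le_power[of "real d" 3]
    by (simp_all add: power2_eq_square power3_eq_cube)
  have "(layer_mean N k (\<lambda>X. F X ^ 4))\<^sup>2 \<le> 144 * real d ^ 3 * (16 * A) ^ (4 * d) * L ^ 4"
  \<comment> \<open>For small \<open>n\<close> the crude factor \<open>W = n + 1\<close> already
    fits under \<open>144 * d ^ 3\<close>, where 144 is the square of the constant 12.\<close>
  proof (cases "real n + 1 \<le> 144 * real d ^ 3")
    case True
    show ?thesis
    proof (rule bound)
      have "(layer_mean N k (\<lambda>X. F X ^ 4))\<^sup>2 \<le> layer_mean N k (\<lambda>X. (F X ^ 4)\<^sup>2)"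
        by (rule layer_mean_squared_le[OF fin k(2)])
      also have "\<dots> \<le> (real n + 1) * cube_mean N (\<lambda>X. (F X ^ 4)\<^sup>2)"
        unfolding n_def by (rule layer_mean_le_cube_mean[OF fin k]) simp
      finally show "(layer_mean N k (\<lambda>X. F X ^ 4))\<^sup>2 \<le> (real n + 1) * cube_mean N (\<lambda>X. (F X ^ 4)\<^sup>2)" .
      have "B * exp 1 \<le> 16 * A"
        unfolding A B_def by (rule scaled_constant_le)
      then have "(B * exp 1) ^ (4 * d) \<le> (16 * A) ^ (4 * d)"
        using nn by (intro power_mono) auto
      then show "(real n + 1) * (B * exp 1) ^ (4 * d) \<le> 144 * real d ^ 3 * (16 * A) ^ (4 * d)"
        using nn by (intro mult_mono[OF True]) auto
    qed simp
  next
    case False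
    \<comment> \<open>Small enough that \<open>(1 + \<theta>) ^ (8 * d)\<close> stays bounded for
      bounded \<open>kappa\<close>, and large enough for the recursion: the condition on
      \<open>s\<close> becomes \<open>25 * d^2 * s <= n - s\<close>, which holds for
      \<open>s < 4 * d\<close> because then \<open>100 * d ^ 3 <= n - s\<close>.\<close>
    define \<theta> where "\<theta> = \<bar>kappa\<bar> / (5 * real d)"
    have \<theta>: "0 \<le> \<theta>"
      by (simp add: \<theta>_def)
    show ?thesis
    proof (rule bound)
      show "(layer_mean N k (\<lambda>X. F X ^ 4))\<^sup>2
          \<le> ((real (4 * d) + 1) * (1 + \<theta>) ^ (2 * (4 * d))) * cube_mean N (\<lambda>X. (F X ^ 4)\<^sup>2)"
      proof (rule lowdeg_layer_mean_le_damped[OF fin k \<theta> _ F4])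
        fix s assume s: "s < 4 * d"
        \<comment> \<open>Integrality turns the strict bound on \<open>n + 1\<close> into a bound on
          \<open>n\<close>.\<close>
        have "real (144 * d ^ 3) < real (n + 1)"
          using False by simp
        then have n: "144 * d ^ 3 \<le> n"
          by (simp only: of_nat_less_iff less_Suc_eq_le Suc_eq_plus1[symmetric])
        have "real (144 * d ^ 3) \<le> real n"
          using n by (simp only: of_nat_le_iff)
        then have nr: "144 * real d ^ 3 \<le> real n"
          by simp
        have sd: "real s \<le> 4 * real d"
          using s by simp
        have "2 * real s \<le> real n"
          using sd nr d3 by linarith
        moreover have "real s * kappa\<^sup>2 \<le> (real n - real s) * \<theta>\<^sup>2"
        proof -
          have "25 * (real d)\<^sup>2 * real s \<le> 25 * (real d)\<^sup>2 * (4 * real d)"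
            using sd by (intro mult_left_mono) auto
          also have "\<dots> = 100 * real d ^ 3"
            using d3 by simp
          also have "\<dots> \<le> real n - real s"
            using nr sd d3 by linarith
          finally have "(25 * (real d)\<^sup>2 * real s) * (kappa\<^sup>2 / (25 * (real d)\<^sup>2))
              \<le> (real n - real s) * (kappa\<^sup>2 / (25 * (real d)\<^sup>2))"
            by (intro mult_right_mono) auto
          then show ?thesis
            using d(1) by (simp add: \<theta>_def power_divide power_mult_distrib)
        qed
        ultimately show "2 * s \<le> card N \<and> real s * kappa\<^sup>2 \<le> (real (card N) - real s) * \<theta>\<^sup>2"
          by (simp add: n_def)
      qed
      have damped: "(1 + \<theta>) ^ (8 * d) * (B * exp 1) ^ (4 * d) \<le> 28 * (16 * A) ^ (4 * d)"
        using damped_constant_le[OF d(1), of kappa] unfolding \<theta>_def A B_def .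
      have "real (4 * d) + 1 = 4 * real d + 1"
        by simp
      also have "\<dots> \<le> 5 * real d ^ 3"
        using d3 by linarith
      finally have "real (4 * d) + 1 \<le> 5 * real d ^ 3" .
      then have "(real (4 * d) + 1) * ((1 + \<theta>) ^ (8 * d) * (B * exp 1) ^ (4 * d))
          \<le> (5 * real d ^ 3) * (28 * (16 * A) ^ (4 * d))"
        using nn \<theta> by (intro mult_mono[OF _ damped]) auto
      also have "\<dots> \<le> 144 * real d ^ 3 * (16 * A) ^ (4 * d)"
        using nn by simp
      finally show "(real (4 * d) + 1) * (1 + \<theta>) ^ (2 * (4 * d)) * (B * exp 1) ^ (4 * d)
          \<le> 144 * real d ^ 3 * (16 * A) ^ (4 * d)"
        by (simp add: mult.assoc)
    qed (use \<theta> in simp)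
  qed
  then show ?thesis
    by (simp add: F_def L_def A_def)
qed

text \<open>Lower the degree to at most \<open>min k (card N - k)\<close>, pass to a harmonic
  representative with the same values on the layer, and take the square root of the squared
  inequality.\<close>

theorem layer_hypercontractive:
  assumes fin: "finite N" and k: "real k = p * real (card N)" "0 < k" "k < card N" and d: "1 \<le> d"
    and F: "F \<in> lowdeg N d"
  shows "layer_mean N k (\<lambda>X. F X ^ 4)
    \<le> 12 * real d powr (3/2) * (256 * (\<alpha> ^ 4 + \<beta> ^ 4)\<^sup>2) ^ d * (layer_mean N k (\<lambda>X. (F X)\<^sup>2))\<^sup>2"
proof -
  define A where "A = \<alpha> ^ 4 + \<beta> ^ 4"
  \<comment> \<open>\<open>0 < k < card N\<close> keeps this degree positive, as the harmonic case
    demands.\<close>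
  define m where "m = min d (min k (card N - k))"
  have m: "1 \<le> m" "m \<le> min k (card N - k)" "m \<le> d"
    using k d by (auto simp: m_def)
  have "\<exists>G\<in>lowdeg N m. \<forall>X\<in>layer N k. G X = F X"
  proof (cases "d \<le> min k (card N - k)")
    case True
    then show ?thesis
      using F by (auto simp: m_def min_absorb1)
  next
    case False
    then have "m = min k (card N - k)"
      by (auto simp: m_def min_def)
    then show ?thesis
      using layer_lowdeg[OF fin] by simp
  qed
  then obtain G where G: "G \<in> lowdeg N m" "\<And>X. X \<in> layer N k \<Longrightarrow> G X = F X"
    by blast
  then obtain c where "degree_le N m c" "\<And>X. G X = fourier N c X"
    by (elim lowdegE) blast
  with harmonic_representation[OF fin k(1), of m c] G(2)
  obtain e where e: "degree_le N m e" "harmonic N e" "\<And>X. X \<in> layer N k \<Longrightarrow> fourier N e X = F X"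
    by metis
  define L where "L = layer_mean N k (\<lambda>X. (F X)\<^sup>2)"
  have L: "0 \<le> L" "layer_mean N k (\<lambda>X. (fourier N e X)\<^sup>2) = L"
    "layer_mean N k (\<lambda>X. fourier N e X ^ 4) = layer_mean N k (\<lambda>X. F X ^ 4)"
    unfolding L_def by (auto intro: layer_mean_nonneg layer_mean_cong simp: e(3))
  have A: "1 \<le> A"
    by (simp add: A_def alpha_beta_fourth)
  have "(layer_mean N k (\<lambda>X. F X ^ 4))\<^sup>2 \<le> 144 * real m ^ 3 * (16 * A) ^ (4 * m) * L ^ 4"
    using harmonic_layer_hypercontractive[OF fin k(1) _ m(1,2) e(1,2)] k(3) by (simp add: L A_def)
  \<comment> \<open>Returning from \<open>m\<close> to \<open>d\<close> only enlarges the constant,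
    because \<open>A >= 1\<close>.\<close>
  also have "\<dots> \<le> 144 * real d ^ 3 * (16 * A) ^ (4 * d) * L ^ 4"
    using m(3) A L(1) by (intro mult_right_mono mult_mono power_mono power_increasing) auto
  also have "\<dots> = (12 * real d powr (3/2) * (256 * A\<^sup>2) ^ d * L\<^sup>2)\<^sup>2"
  proof -
    have "(real d powr (3/2))\<^sup>2 = real d ^ 3"
      using d by (simp add: powr_power powr_numeral)
    moreover have "((256 * A\<^sup>2) ^ d)\<^sup>2 = (16 * A) ^ (4 * d)"
    proof -
      have "256 * A\<^sup>2 = (16 * A)\<^sup>2" "2 * d * 2 = 4 * d"
        by (simp_all add: power_mult_distrib)
      then show ?thesis
        by (simp only: power_mult[symmetric])
    qed
    moreover have "(12 * P * M * L\<^sup>2)\<^sup>2 = 144 * P\<^sup>2 * M\<^sup>2 * L ^ 4" for P M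
      by (simp add: power_mult_distrib flip: power_mult)
    ultimately show ?thesis
      by (simp only:)
  qed
  finally have "(layer_mean N k (\<lambda>X. F X ^ 4))\<^sup>2 \<le> (12 * real d powr (3/2) * (256 * A\<^sup>2) ^ d * L\<^sup>2)\<^sup>2" .
  then show ?thesis
    unfolding L_def[symmetric] A_def[symmetric] by (rule power2_le_imp_le) (use L A in simp)
qed

subsection \<open>Polynomials on the slice\<close>

text \<open>In a multilinear polynomial every exponent that occurs is 1, so a monomial is a plain
  product over its keys and its degree is their number.\<close>

lemma eval_poly_affine_lowdeg:
  assumes "finite N" "multilinear f" "poly_vars f \<subseteq> N" "total_degree f \<le> d"
  shows "(\<lambda>X. eval_poly f (\<lambda>i. u + v * chi i X)) \<in> lowdeg N d"
  unfolding eval_poly_def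
proof (intro lowdeg_sum lowdeg_scale)
  fix m assume m: "m \<in> Poly_Mapping.keys f"
  have one: "Poly_Mapping.lookup m i = 1" if "i \<in> Poly_Mapping.keys m" for i
  proof -
    have "Poly_Mapping.lookup m i \<noteq> 0"
      using that by (simp add: in_keys_iff)
    moreover have "Poly_Mapping.lookup m i \<le> 1"
      using assms(2) m unfolding multilinear_def by blast
    ultimately show ?thesis by simp
  qed
  have "card (Poly_Mapping.keys m) = monomial_degree m"
    by (simp add: monomial_degree_def one)
  also have "\<dots> \<le> total_degree f"
    unfolding total_degree_def using m by (intro Max_ge) auto
  finally have "card (Poly_Mapping.keys m) \<le> d"
    using assms(4) by simp
  moreover have "Poly_Mapping.keys m \<subseteq> N"
    using assms(3) m by (auto simp: poly_vars_def)
  ultimately have "(\<lambda>X. \<Prod>i\<in>Poly_Mapping.keys m. u + v * chi i X) \<in> lowdeg N d"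
    using lowdeg_mono[OF lowdeg_prod_affine[OF assms(1), of _ "\<lambda>_. u" "\<lambda>_. v"]] by blast
  then show "(\<lambda>X. \<Prod>i\<in>Poly_Mapping.keys m. (u + v * chi i X) ^ Poly_Mapping.lookup m i) \<in> lowdeg N d"
    by (simp add: one cong: prod.cong)
qed

end

lemma eval_poly_cong: "(\<And>i. i \<in> poly_vars f \<Longrightarrow> y i = z i) \<Longrightarrow> eval_poly f y = eval_poly f z"
  unfolding eval_poly_def poly_vars_def
  by (intro sum.cong arg_cong2[where f = "\<lambda>a b. a * b"]
      prod.cong arg_cong2[where f = "\<lambda>a b. a ^ b"] refl) blast

text \<open>Restricted to \<open>{1..n}\<close> because the members of \<open>slice\<close> are
  extensional functions.\<close>

definition sign_vector :: "nat \<Rightarrow> nat set \<Rightarrow> nat \<Rightarrow> real" where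
  "sign_vector n X = restrict (\<lambda>i. if i \<in> X then -1 else 1) {1..n}"

lemma sum_sign_vector:
  assumes "X \<subseteq> {1..n}"
  shows "(\<Sum>i=1..n. sign_vector n X i) = real n - 2 * real (card X)"
proof -
  have "(\<Sum>i=1..n. sign_vector n X i) = (\<Sum>i=1..n. 1 - 2 * (if i \<in> X then 1 else 0))"
    by (intro sum.cong) (auto simp: sign_vector_def)
  also have "\<dots> = real n - 2 * (\<Sum>i=1..n. if i \<in> X then 1 else 0)"
    by (simp add: sum_subtractf sum_distrib_left[symmetric])
  also have "(\<Sum>i=1..n. if i \<in> X then 1 else 0) = (\<Sum>i\<in>X. 1::real)"
    using assms by (subst sum.inter_restrict[symmetric]) (auto simp: Int_absorb2 Int_commute)
  finally show ?thesis
    by simp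
qed

text \<open>\<open>sign_vector\<close> is a bijection from the layer to the slice: its coordinate
  sum is \<open>n - 2 * card X\<close>, so the slice condition says
  \<open>card X = p * n\<close>.\<close>

lemma expectation_slice_pmf:
  assumes k: "real k = p * real n" and p: "0 < p" "p < 1"
  shows "measure_pmf.expectation (slice_pmf n p) F = layer_mean {1..n} k (\<lambda>X. F (sign_vector n X))"
proof -
  have sum: "(\<Sum>x\<in>slice n p. G x) = (\<Sum>X\<in>layer {1..n} k. G (sign_vector n X))" for G :: "(nat \<Rightarrow> real) \<Rightarrow> real"
  proof (rule sum.reindex_bij_witness[of _ "sign_vector n" "\<lambda>x. {i\<in>{1..n}. x i = -1}"])
    fix x assume x: "x \<in> slice n p"
    then have xv: "x \<in> {1..n} \<rightarrow>\<^sub>E {-1, 1}"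
      by (simp add: slice_def)
    show inv: "sign_vector n {i \<in> {1..n}. x i = - 1} = x"
    proof
      fix i
      show "sign_vector n {i \<in> {1..n}. x i = - 1} i = x i"
      proof (cases "i \<in> {1..n}")
        case True
        then have "x i \<in> {-1, 1}"
          using xv by blast
        then show ?thesis
          using True by (auto simp: sign_vector_def)
      next
        case False
        with xv have "x i = undefined"
          by (rule PiE_arb)
        then show ?thesis
          using False by (simp only: sign_vector_def restrict_def if_False)
      qed
    qed
    have "{i \<in> {1..n}. x i = - 1} \<subseteq> {1..n}"
      by blast
    from sum_sign_vector[OF this] have "real n - 2 * real (card {i \<in> {1..n}. x i = - 1}) = (\<Sum>i=1..n. x i)"
      unfolding inv by (rule sym)
    also have "\<dots> = (1 - 2 * p) * real n"
      using x by (simp add: slice_def)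
    finally have "real n - 2 * real (card {i \<in> {1..n}. x i = - 1}) = (1 - 2 * p) * real n" .
    then have "real (card {i \<in> {1..n}. x i = - 1}) = real k"
      by (simp add: k algebra_simps)
    then show "{i \<in> {1..n}. x i = - 1} \<in> layer {1..n} k"
      by (auto simp: layer_def)
    show "G (sign_vector n {i \<in> {1..n}. x i = - 1}) = G x"
      by (simp only: inv)
  next
    fix X assume X: "X \<in> layer {1..n} k"
    then show "{i \<in> {1..n}. sign_vector n X i = - 1} = X"
      by (auto simp: layer_def sign_vector_def)
    have "(\<Sum>i=1..n. sign_vector n X i) = (1 - 2 * p) * real n"
      using X k by (subst sum_sign_vector) (auto simp: layer_def algebra_simps)
    then show "sign_vector n X \<in> slice n p"
      by (auto simp: slice_def sign_vector_def)
  qed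
  have "real k \<in> \<int>"
    by simp
  then have "slice n p \<noteq> {}"
    using p k by (intro slice_nonempty) auto
  then have "measure_pmf.expectation (slice_pmf n p) F = (\<Sum>x\<in>slice n p. F x) / real (card (slice n p))"
    unfolding slice_pmf_def by (simp add: integral_pmf_of_set finite_slice)
  also have "real (card (slice n p)) = real (n choose k)"
    using sum[of "\<lambda>_. 1"] by (simp add: card_layer)
  finally show ?thesis
    by (simp add: sum layer_mean_def)
qed

theorem corollary5p2:
  fixes d n :: nat and p :: real
  assumes "1 \<le> d" and "0 < p" and "p < 1" and "0 < n" and "p * real n \<in> \<int>"
  shows "(\<forall>f. multilinear f \<and> poly_vars f \<subseteq> {1..n} \<and> total_degree f \<le> d \<longrightarrow>
           measure_pmf.expectation (slice_pmf n p) (\<lambda>x. eval_poly f (\<lambda>i. phi p (x i)) ^ 4)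
             \<le> hyper_const d p *
               (measure_pmf.expectation (slice_pmf n p) (\<lambda>x. eval_poly f (\<lambda>i. phi p (x i)) ^ 2))\<^sup>2)
       \<and> (\<forall>g. multilinear g \<and> poly_vars g \<subseteq> {1..n} \<and> total_degree g \<le> d \<longrightarrow>
           measure_pmf.expectation (slice_pmf n p) (\<lambda>x. eval_poly g x ^ 4)
             \<le> hyper_const d p *
               (measure_pmf.expectation (slice_pmf n p) (\<lambda>x. eval_poly g x ^ 2))\<^sup>2)"
proof -
  define \<alpha> where "\<alpha> = sqrt (p / (1 - p))"
  define \<beta> where "\<beta> = sqrt ((1 - p) / p)"
  have pos: "0 < \<alpha>" "0 < \<beta>"
    using assms by (auto simp: \<alpha>_def \<beta>_def)
  have ab: "\<alpha> * \<beta> = 1"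
    using assms by (simp add: \<alpha>_def \<beta>_def flip: real_sqrt_mult)
  have a2: "(1 - p) * \<alpha>\<^sup>2 = p"
    using assms by (simp add: \<alpha>_def)
  have "((1 - p) * \<alpha>) = ((1 - p) * \<alpha>\<^sup>2) * \<beta>"
    using ab by (simp add: power2_eq_square mult.assoc)
  then have bal: "(1 - p) * \<alpha> = p * \<beta>"
    by (simp only: a2)
  interpret biased_cube p \<alpha> \<beta>
    using assms pos ab bal by unfold_locales
  have K: "hyper_const d p = 12 * real d powr (3/2) * (256 * (\<alpha> ^ 4 + \<beta> ^ 4)\<^sup>2) ^ d"
  proof -
    have "sqrt x ^ 4 = x\<^sup>2" if "0 \<le> x" for x
    proof -
      have "sqrt x ^ 4 = ((sqrt x)\<^sup>2)\<^sup>2"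
        by (simp flip: power_mult)
      then show ?thesis
        using that by simp
    qed
    then show ?thesis
      using assms by (simp add: hyper_const_def \<alpha>_def \<beta>_def add.commute)
  qed
  obtain z where z: "p * real n = of_int z"
    using assms(5) by (elim Ints_cases)
  have "0 < p * real n" "p * real n < 1 * real n"
    using assms by simp_all
  \<comment> \<open>Strictness of \<open>0 < p < 1\<close> excludes the two trivial layers.\<close>
  then have zb: "0 < z" "z < int n"
    unfolding z by linarith+
  define k where "k = nat z"
  have k: "real k = p * real n" "0 < k" "k < n"
    using zb by (simp_all add: k_def z)
  \<comment> \<open>Both halves of the claim evaluate a polynomial at coordinates that are affine in
    the characters, so they are treated at once.\<close>
  have main: "measure_pmf.expectation (slice_pmf n p) (\<lambda>x. eval_poly f (y x) ^ 4)
      \<le> hyper_const d p * (measure_pmf.expectation (slice_pmf n p) (\<lambda>x. eval_poly f (y x) ^ 2))\<^sup>2"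
    if f: "multilinear f" "poly_vars f \<subseteq> {1..n}" "total_degree f \<le> d"
      and y: "\<And>X i. i \<in> {1..n} \<Longrightarrow> y (sign_vector n X) i = u + v * chi i X" for f y u v
  proof -
    have eq: "eval_poly f (y (sign_vector n X)) = eval_poly f (\<lambda>i. u + v * chi i X)" for X
      using f(2) y by (intro eval_poly_cong) auto
    have "(\<lambda>X. eval_poly f (\<lambda>i. u + v * chi i X)) \<in> lowdeg {1..n} d"
      using f by (intro eval_poly_affine_lowdeg) auto
    from layer_hypercontractive[OF _ _ k(2) _ assms(1) this] show ?thesis
      using k unfolding expectation_slice_pmf[OF k(1) assms(2,3)] eq K by simp
  qed
  \<comment> \<open>The slope of the affine map from character to sign: the sign jumps by 2 where
    the character jumps by \<open>\<alpha> + \<beta>\<close>.\<close>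
  define v where "v = 2 / (\<alpha> + \<beta>)"
  have "phi p 1 = \<alpha>" "phi p (- 1) = - \<beta>"
    by (simp_all add: phi_def \<alpha>_def \<beta>_def)
  then have phi: "phi p (sign_vector n X i) = 0 + 1 * chi i X" if "i \<in> {1..n}" for X i
    using that by (simp add: sign_vector_def chi_def)
  have sign: "sign_vector n X i = (1 - v * \<alpha>) + v * chi i X" if "i \<in> {1..n}" for X i
  proof -
    have "v * (\<alpha> + \<beta>) = 2"
      using v_def pos unfolding eq_divide_eq by auto
    then show ?thesis
      using that by (auto simp: sign_vector_def chi_def algebra_simps)
  qed
  show ?thesis
  proof (intro conjI allI impI; elim conjE)
    fix f assume f: "multilinear f" "poly_vars f \<subseteq> {1..n}" "total_degree f \<le> d"
    show "measure_pmf.expectation (slice_pmf n p) (\<lambda>x. eval_poly f (\<lambda>i. phi p (x i)) ^ 4)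
        \<le> hyper_const d p *
          (measure_pmf.expectation (slice_pmf n p) (\<lambda>x. eval_poly f (\<lambda>i. phi p (x i)) ^ 2))\<^sup>2"
      by (rule main[OF f]) (rule phi)
    show "measure_pmf.expectation (slice_pmf n p) (\<lambda>x. eval_poly f x ^ 4)
        \<le> hyper_const d p * (measure_pmf.expectation (slice_pmf n p) (\<lambda>x. eval_poly f x ^ 2))\<^sup>2"
      by (rule main[OF f]) (rule sign)
  qed
qed

end
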